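(* Let $G=G([n],E)$ be a connected simple graph and $\Delta=\mathrm{conv}\{e_1,\dots,e_n\}\subseteq\mathbb{R}^{[n]}$. Let $\mathcal{X}_G$ be the polytopal complex of all faces of the subdivision of $\Delta$ induced by the graphical arrangement of $G$ (the hyperplanes $x_i=x_j$ for $\{i,j\}\in E$). Then $\mathcal{X}_G$ is a polytopal complex realization of the abstract cell complex $\mathscr{X}_G^\ast$: there is a bijection between the relatively open cells of $\mathcal{X}_G$ and the elements of $\mathscr{X}_G^\ast$ under which containment of closures corresponds to $\preceq_x$ and affine dimension corresponds to $\dim_x$.
   Context: Partial acyclic orientations: an orientation of a graph $H$ assigns to each edge $e=\{u,v\}$ one of $e$ (undirected), $(u,v)$, $(v,u)$. A partition $\Sigma$ of the vertex set is a connected partition if each block induces a connected subgraph; the partition graph $H^\Sigma$ has vertex set $\Sigma$, with distinct blocks adjacent iff some edge joins them. An orientation $O$ of $H$ is a p.a.o. if there are a connected partition $\Sigma$ and an acyclic orientation $O^\Sigma$ of $H^\Sigma$ (all edges oriented, no directed cycles) such that edges inside blocks are undirected and each edge $\{u,v\}$ with $u\in\sigma\neq\rho\ni v$ is oriented $(u,v)$ when $O^\Sigma$ orients $\{\sigma,\rho\}$ as $(\sigma,\rho)$. Put $\dim_H(O)=|V(H)|-|\Sigma|$, and let $J_H(O)$ be the collection of all unions $\bigcup_{\sigma\in I}\sigma$ over order ideals $I$ (including $\emptyset$) of the poset on $\Sigma$ induced by $O^\Sigma$. $G[\sigma]$ denotes the induced subgraph on $\sigma$. The abstract cell complex $\mathscr{X}_G^\ast$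 has as elements all pairs $(\sigma,O)$ with $\emptyset\neq\sigma\subseteq[n]$ and $O$ a p.a.o. of $G[\sigma]$, ordered by $(\sigma_0,O_0)\preceq_x(\sigma_1,O_1)$ iff $J_{G[\sigma_0]}(O_0)\subseteq J_{G[\sigma_1]}(O_1)$, with dimension $\dim_x(\sigma,O)=|\sigma|-1-\dim_{G[\sigma]}(O)$. *)

theory Defs
  imports "HOL-Analysis.Analysis" "HOL-Library.Disjoint_Sets" "HOL-Library.FuncSet"
begin

section \<open>Graphs\<close>

record 'a ugraph =
  verts :: "'a set"
  edges :: "'a set set"

definition simple_graph :: "'a ugraph \<Rightarrow> bool" where
  "simple_graph H \<longleftrightarrow> finite (verts H) \<and> (\<forall>e\<in>edges H. e \<subseteq> verts H \<and> card e = 2)"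

definition connected_graph :: "'a ugraph \<Rightarrow> bool" where
  "connected_graph H \<longleftrightarrow> verts H \<noteq> {} \<and>
     (\<forall>u\<in>verts H. \<forall>v\<in>verts H. (u, v) \<in> {(x, y). {x, y} \<in> edges H}\<^sup>*)"

definition induced_subgraph :: "'a ugraph \<Rightarrow> 'a set \<Rightarrow> 'a ugraph" where
  "induced_subgraph H \<sigma> = \<lparr>verts = \<sigma>, edges = {e \<in> edges H. e \<subseteq> \<sigma>}\<rparr>"

definition connected_partition :: "'a ugraph \<Rightarrow> 'a set set \<Rightarrow> bool" where
  "connected_partition H \<Sigma> \<longleftrightarrow>
     partition_on (verts H) \<Sigma> \<and> (\<forall>\<sigma>\<in>\<Sigma>. connected_graph (induced_subgraph H \<sigma>))"

definition partition_graph :: "'a ugraph \<Rightarrow> 'a set set \<Rightarrow> 'a set ugraph" where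
  "partition_graph H \<Sigma> =
     \<lparr>verts = \<Sigma>,
      edges = {{\<sigma>, \<rho>} | \<sigma> \<rho>. \<sigma> \<in> \<Sigma> \<and> \<rho> \<in> \<Sigma> \<and> \<sigma> \<noteq> \<rho> \<and> (\<exists>u\<in>\<sigma>. \<exists>v\<in>\<rho>. {u, v} \<in> edges H)}\<rparr>"


section \<open>Partial acyclic orientations\<close>

datatype 'a oriented_edge = Undirected "'a set" | Directed 'a 'a

text \<open>
  Orientations are extensional functions on the edge set, so that two orientations are equal
  iff they agree on every edge.
\<close>

definition orientation :: "'a ugraph \<Rightarrow> ('a set \<Rightarrow> 'a oriented_edge) \<Rightarrow> bool" where
  "orientation H \<omega> \<longleftrightarrow>
     \<omega> \<in> (\<Pi>\<^sub>E e\<in>edges H. insert (Undirected e) {Directed u v | u v. e = {u, v}})"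

definition arcs :: "'a ugraph \<Rightarrow> ('a set \<Rightarrow> 'a oriented_edge) \<Rightarrow> ('a \<times> 'a) set" where
  "arcs H \<omega> = {(u, v). \<exists>e\<in>edges H. \<omega> e = Directed u v}"

definition acyclic_orientation :: "'a ugraph \<Rightarrow> ('a set \<Rightarrow> 'a oriented_edge) \<Rightarrow> bool" where
  "acyclic_orientation H \<omega> \<longleftrightarrow>
     orientation H \<omega> \<and> (\<forall>e\<in>edges H. \<omega> e \<noteq> Undirected e) \<and> acyclic (arcs H \<omega>)"

definition pao_witness ::
  "'a ugraph \<Rightarrow> ('a set \<Rightarrow> 'a oriented_edge) \<Rightarrow> 'a set set \<Rightarrow> ('a set set \<Rightarrow> 'a set oriented_edge) \<Rightarrow> bool"
  where
  "pao_witness H \<omega> \<Sigma> \<pi> \<longleftrightarrow>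
     connected_partition H \<Sigma> \<and> acyclic_orientation (partition_graph H \<Sigma>) \<pi> \<and>
     (\<forall>\<sigma>\<in>\<Sigma>. \<forall>u\<in>\<sigma>. \<forall>v\<in>\<sigma>. {u, v} \<in> edges H \<longrightarrow> \<omega> {u, v} = Undirected {u, v}) \<and>
     (\<forall>\<sigma>\<in>\<Sigma>. \<forall>\<rho>\<in>\<Sigma>. \<sigma> \<noteq> \<rho> \<longrightarrow>
        (\<forall>u\<in>\<sigma>. \<forall>v\<in>\<rho>. {u, v} \<in> edges H \<longrightarrow> \<pi> {\<sigma>, \<rho>} = Directed \<sigma> \<rho> \<longrightarrow>
           \<omega> {u, v} = Directed u v))"

definition pao :: "'a ugraph \<Rightarrow> ('a set \<Rightarrow> 'a oriented_edge) \<Rightarrow> bool" where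
  "pao H \<omega> \<longleftrightarrow> orientation H \<omega> \<and> (\<exists>\<Sigma> \<pi>. pao_witness H \<omega> \<Sigma> \<pi>)"

text \<open>The partition and its acyclic orientation are determined by the p.a.o.\<close>

lemma pao_witness_cross:
  assumes w: "pao_witness H \<omega> \<Sigma> \<pi>"
    and sr: "\<sigma> \<in> \<Sigma>" "\<rho> \<in> \<Sigma>" "\<sigma> \<noteq> \<rho>" "u \<in> \<sigma>" "v \<in> \<rho>" "{u, v} \<in> edges H"
  shows "(\<pi> {\<sigma>, \<rho>} = Directed \<sigma> \<rho> \<and> \<omega> {u, v} = Directed u v)
       \<or> (\<pi> {\<sigma>, \<rho>} = Directed \<rho> \<sigma> \<and> \<omega> {u, v} = Directed v u)"
proof -
  let ?H = "partition_graph H \<Sigma>"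
  have e: "{\<sigma>, \<rho>} \<in> edges ?H"
    unfolding partition_graph_def ugraph.simps using sr by blast
  have acyc: "acyclic_orientation ?H \<pi>"
    and dir: "\<And>\<sigma> \<rho> u v. \<sigma> \<in> \<Sigma> \<Longrightarrow> \<rho> \<in> \<Sigma> \<Longrightarrow> \<sigma> \<noteq> \<rho> \<Longrightarrow> u \<in> \<sigma> \<Longrightarrow> v \<in> \<rho> \<Longrightarrow>
      {u, v} \<in> edges H \<Longrightarrow> \<pi> {\<sigma>, \<rho>} = Directed \<sigma> \<rho> \<Longrightarrow> \<omega> {u, v} = Directed u v"
    using w[unfolded pao_witness_def, THEN conjunct2, THEN conjunct1]
      w[unfolded pao_witness_def, THEN conjunct2, THEN conjunct2, THEN conjunct2] by simp_all
  have "\<pi> {\<sigma>, \<rho>} \<in> insert (Undirected {\<sigma>, \<rho>}) {Directed a b | a b. {\<sigma>, \<rho>} = {a, b}}"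
    by (rule PiE_mem[OF acyc[unfolded acyclic_orientation_def orientation_def, THEN conjunct1] e])
  moreover have "\<pi> {\<sigma>, \<rho>} \<noteq> Undirected {\<sigma>, \<rho>}"
    using acyc[unfolded acyclic_orientation_def, THEN conjunct2, THEN conjunct1] e by (rule bspec)
  ultimately have "\<pi> {\<sigma>, \<rho>} = Directed \<sigma> \<rho> \<or> \<pi> {\<sigma>, \<rho>} = Directed \<rho> \<sigma>"
    by (auto simp: doubleton_eq_iff)
  then show ?thesis
  proof
    assume "\<pi> {\<sigma>, \<rho>} = Directed \<sigma> \<rho>"
    then show ?thesis using dir[OF sr] by simp
  next
    assume *: "\<pi> {\<sigma>, \<rho>} = Directed \<rho> \<sigma>"
    have "\<omega> {v, u} = Directed v u"
      by (rule dir[OF sr(2,1) sr(3)[symmetric] sr(5,4)])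
         (use sr(6) * in \<open>simp_all only: insert_commute[of v u] insert_commute[of \<rho> \<sigma>]\<close>)
    then show ?thesis using * by (simp only: insert_commute[of v u]) simp
  qed
qed

lemma pao_witness_block_subset:
  assumes w: "pao_witness H \<omega> \<Sigma> \<pi>" and w': "pao_witness H \<omega> \<Sigma>' \<pi>'"
    and "\<sigma> \<in> \<Sigma>" "\<sigma>' \<in> \<Sigma>'" "u \<in> \<sigma>" "u \<in> \<sigma>'"
  shows "\<sigma> \<subseteq> \<sigma>'"
proof
  fix v assume "v \<in> \<sigma>"
  have part: "partition_on (verts H) \<Sigma>" "partition_on (verts H) \<Sigma>'"
    and conn: "connected_graph (induced_subgraph H \<sigma>)"
    using w w' \<open>\<sigma> \<in> \<Sigma>\<close> by (auto simp: pao_witness_def connected_partition_def)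
  have "(u, v) \<in> {(x, y). {x, y} \<in> edges H \<and> {x, y} \<subseteq> \<sigma>}\<^sup>*"
    using conn \<open>u \<in> \<sigma>\<close> \<open>v \<in> \<sigma>\<close> by (auto simp: connected_graph_def induced_subgraph_def)
  then show "v \<in> \<sigma>'"
  proof (induction rule: rtrancl_induct)
    case base
    show ?case by fact
  next
    case (step x y)
    then have e: "{x, y} \<in> edges H" "x \<in> \<sigma>" "y \<in> \<sigma>" by auto
    then have und: "\<omega> {x, y} = Undirected {x, y}"
      using w \<open>\<sigma> \<in> \<Sigma>\<close> by (auto simp: pao_witness_def)
    have "y \<in> \<Union>\<Sigma>'"
      using part e \<open>\<sigma> \<in> \<Sigma>\<close> by (auto simp: partition_on_def)
    then obtain \<rho>' where \<rho>': "\<rho>' \<in> \<Sigma>'" "y \<in> \<rho>'" by auto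
    show ?case
    proof (rule ccontr)
      assume "y \<notin> \<sigma>'"
      then have ne: "\<sigma>' \<noteq> \<rho>'" using \<rho>' by auto
      have "{x, y} \<in> edges H" by fact
      from pao_witness_cross[OF w' \<open>\<sigma>' \<in> \<Sigma>'\<close> \<rho>'(1) ne step.IH \<rho>'(2) this]
      have "\<omega> {x, y} = Directed x y \<or> \<omega> {x, y} = Directed y x" by blast
      then show False using und by auto
    qed
  qed
qed

lemma pao_witness_unique_partition:
  assumes "pao_witness H \<omega> \<Sigma> \<pi>" "pao_witness H \<omega> \<Sigma>' \<pi>'"
  shows "\<Sigma> = \<Sigma>'"
proof -
  have sub: "\<Sigma>\<^sub>1 \<subseteq> \<Sigma>\<^sub>2"
    if w: "pao_witness H \<omega> \<Sigma>\<^sub>1 \<pi>\<^sub>1" "pao_witness H \<omega> \<Sigma>\<^sub>2 \<pi>\<^sub>2" for \<Sigma>\<^sub>1 \<Sigma>\<^sub>2 \<pi>\<^sub>1 \<pi>\<^sub>2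
  proof
    fix \<sigma> assume \<sigma>: "\<sigma> \<in> \<Sigma>\<^sub>1"
    have part: "partition_on (verts H) \<Sigma>\<^sub>1" "partition_on (verts H) \<Sigma>\<^sub>2"
      using w by (auto simp: pao_witness_def connected_partition_def)
    have "\<sigma> \<noteq> {}" using part \<sigma> by (auto simp: partition_on_def)
    then obtain u where u: "u \<in> \<sigma>" by blast
    then have "u \<in> \<Union>\<Sigma>\<^sub>2" using part \<sigma> by (auto simp: partition_on_def)
    then obtain \<rho> where \<rho>: "\<rho> \<in> \<Sigma>\<^sub>2" "u \<in> \<rho>" by auto
    have "\<sigma> = \<rho>"
      using pao_witness_block_subset[OF w \<sigma> \<rho>(1) u \<rho>(2)]
        pao_witness_block_subset[OF w(2) w(1) \<rho>(1) \<sigma> \<rho>(2) u] by simp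
    then show "\<sigma> \<in> \<Sigma>\<^sub>2" using \<rho> by simp
  qed
  show ?thesis using sub[OF assms] sub[OF assms(2) assms(1)] by simp
qed

lemma pao_witness_unique_orientation:
  assumes w: "pao_witness H \<omega> \<Sigma> \<pi>" and w': "pao_witness H \<omega> \<Sigma> \<pi>'"
  shows "\<pi> = \<pi>'"
proof (rule PiE_ext)
  let ?H = "partition_graph H \<Sigma>"
  let ?F = "\<lambda>e. insert (Undirected e) {Directed u v | u v. e = {u, v}}"
  show "\<pi> \<in> (\<Pi>\<^sub>E e\<in>edges ?H. ?F e)" "\<pi>' \<in> (\<Pi>\<^sub>E e\<in>edges ?H. ?F e)"
    using w w' by (auto simp: pao_witness_def acyclic_orientation_def orientation_def)
  fix e assume e: "e \<in> edges ?H"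
  then obtain \<sigma> \<rho> u v where sr: "e = {\<sigma>, \<rho>}" "\<sigma> \<in> \<Sigma>" "\<rho> \<in> \<Sigma>" "\<sigma> \<noteq> \<rho>"
      "u \<in> \<sigma>" "v \<in> \<rho>" "{u, v} \<in> edges H"
    by (auto simp: partition_graph_def)
  have dis: "\<sigma> \<inter> \<rho> = {}"
    using w sr by (auto simp: pao_witness_def connected_partition_def partition_on_def disjoint_def)
  then have uv: "u \<noteq> v" using sr by auto
  show "\<pi> e = \<pi>' e"
    using pao_witness_cross[OF w sr(2-7)] pao_witness_cross[OF w' sr(2-7)] uv sr(1) by auto
qed

definition pao_partition :: "'a ugraph \<Rightarrow> ('a set \<Rightarrow> 'a oriented_edge) \<Rightarrow> 'a set set" where
  "pao_partition H \<omega> = (THE \<Sigma>. \<exists>\<pi>. pao_witness H \<omega> \<Sigma> \<pi>)"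

definition pao_quotient ::
  "'a ugraph \<Rightarrow> ('a set \<Rightarrow> 'a oriented_edge) \<Rightarrow> 'a set set \<Rightarrow> 'a set oriented_edge" where
  "pao_quotient H \<omega> = (THE \<pi>. pao_witness H \<omega> (pao_partition H \<omega>) \<pi>)"

lemma pao_witness_eq:
  assumes "pao_witness H \<omega> \<Sigma> \<pi>"
  shows "pao_partition H \<omega> = \<Sigma>" "pao_quotient H \<omega> = \<pi>"
proof -
  show *: "pao_partition H \<omega> = \<Sigma>"
    unfolding pao_partition_def
    by (rule the_equality) (use assms in \<open>auto dest: pao_witness_unique_partition\<close>)
  show "pao_quotient H \<omega> = \<pi>"
    unfolding pao_quotient_def *
    by (rule the_equality) (use assms in \<open>auto dest: pao_witness_unique_orientation\<close>)
qed

definition pao_dim :: "'a ugraph \<Rightarrow> ('a set \<Rightarrow> 'a oriented_edge) \<Rightarrow> int" where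
  "pao_dim H \<omega> = int (card (verts H)) - int (card (pao_partition H \<omega>))"

text \<open>
  In the poset induced by an acyclic orientation, \<open>\<sigma> \<le> \<rho>\<close> iff there is a directed path from
  \<open>\<sigma>\<close> to \<open>\<rho>\<close>.
\<close>

definition pao_order :: "'a ugraph \<Rightarrow> ('a set \<Rightarrow> 'a oriented_edge) \<Rightarrow> ('a set \<times> 'a set) set" where
  "pao_order H \<omega> = (arcs (partition_graph H (pao_partition H \<omega>)) (pao_quotient H \<omega>))\<^sup>*"

definition order_ideal :: "'a set \<Rightarrow> ('a \<times> 'a) set \<Rightarrow> 'a set \<Rightarrow> bool" where
  "order_ideal A r I \<longleftrightarrow> I \<subseteq> A \<and> (\<forall>x\<in>A. \<forall>y\<in>I. (x, y) \<in> r \<longrightarrow> x \<in> I)"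

definition pao_ideals :: "'a ugraph \<Rightarrow> ('a set \<Rightarrow> 'a oriented_edge) \<Rightarrow> 'a set set" where
  "pao_ideals H \<omega> = {\<Union>I | I. order_ideal (pao_partition H \<omega>) (pao_order H \<omega>) I}"


section \<open>The abstract cell complex of a graph\<close>

definition abs_cells :: "'a ugraph \<Rightarrow> ('a set \<times> ('a set \<Rightarrow> 'a oriented_edge)) set" where
  "abs_cells G = {(\<sigma>, \<omega>). \<sigma> \<noteq> {} \<and> \<sigma> \<subseteq> verts G \<and> pao (induced_subgraph G \<sigma>) \<omega>}"

definition abs_le ::
  "'a ugraph \<Rightarrow> 'a set \<times> ('a set \<Rightarrow> 'a oriented_edge) \<Rightarrow> 'a set \<times> ('a set \<Rightarrow> 'a oriented_edge) \<Rightarrow> bool"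
  where
  "abs_le G = (\<lambda>(\<sigma>\<^sub>0, \<omega>\<^sub>0) (\<sigma>\<^sub>1, \<omega>\<^sub>1).
     pao_ideals (induced_subgraph G \<sigma>\<^sub>0) \<omega>\<^sub>0 \<subseteq> pao_ideals (induced_subgraph G \<sigma>\<^sub>1) \<omega>\<^sub>1)"

definition abs_dim :: "'a ugraph \<Rightarrow> 'a set \<times> ('a set \<Rightarrow> 'a oriented_edge) \<Rightarrow> int" where
  "abs_dim G = (\<lambda>(\<sigma>, \<omega>). int (card \<sigma>) - 1 - pao_dim (induced_subgraph G \<sigma>) \<omega>)"


section \<open>The graphical subdivision of the standard simplex\<close>

definition polytopal_complex :: "'a::euclidean_space set set \<Rightarrow> bool" where
  "polytopal_complex K \<longleftrightarrow>
     finite K \<and> (\<forall>P\<in>K. polytope P) \<and>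
     (\<forall>P\<in>K. \<forall>F. F face_of P \<longrightarrow> F \<in> K) \<and>
     (\<forall>P\<in>K. \<forall>Q\<in>K. (P \<inter> Q) face_of P \<and> (P \<inter> Q) face_of Q)"

text \<open>
  A polytopal complex contains the empty face, which is not counted as a cell.
\<close>

definition open_cells :: "'a::euclidean_space set set \<Rightarrow> 'a set set" where
  "open_cells K = {rel_interior P | P. P \<in> K \<and> P \<noteq> {}}"

definition std_simplex :: "(real ^ 'n) set" where
  "std_simplex = convex hull (range (\<lambda>i. axis i 1))"

definition graphical_arrangement :: "'n ugraph \<Rightarrow> (real ^ 'n) set set" where
  "graphical_arrangement G = {{x. x $ i = x $ j} | i j. {i, j} \<in> edges G}"

definition arrangement_regions :: "'a::euclidean_space set set \<Rightarrow> 'a set set" where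
  "arrangement_regions \<H> = components (- \<Union>\<H>)"

definition graphical_complex :: "'n::finite ugraph \<Rightarrow> (real ^ 'n) set set" where
  "graphical_complex G =
     {F. \<exists>R\<in>arrangement_regions (graphical_arrangement G). F face_of (std_simplex \<inter> closure R)}"

end

theory Submission
  imports Defs
begin

text \<open>
  A point \<open>w\<close> of the simplex determines its support \<open>\<sigma>\<close> and the orientation of \<open>G[\<sigma>]\<close> in which
  every edge points from the larger to the smaller coordinate and ties are undirected. Topological
  sorting of the quotient shows that every p.a.o. arises in this way. The points satisfying the
  same weak inequalities as \<open>w\<close> form the closed cell with \<open>w\<close> in its relative interior; closed cells
  of points of \<open>closed_cell G w\<close> are exactly its nonempty faces, and the cells of generic points are
  the traces of the closed regions of the arrangement.

  The ideals of the orientation of \<open>w\<close> are the sets \<open>U \<subseteq> \<sigma>\<close> closed under passing to neighbours of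
  at least the same weight. The nonempty ones are precisely the sets whose barycentre lies in the
  closed cell of \<open>w\<close>, and they include the superlevel sets of \<open>w\<close>; hence containment of ideals is containment of
  cells. The barycentres of the blocks of the partition are an affine basis of the affine hull of
  the cell, which gives the dimension.
\<close>

section \<open>Closed cells and their faces\<close>

lemma mem_std_simplex_iff:
  fixes y :: "real ^ 'n::finite"
  shows "y \<in> std_simplex \<longleftrightarrow> (\<forall>i. 0 \<le> y $ i) \<and> (\<Sum>i\<in>UNIV. y $ i) = 1"
proof
  let ?S = "{y :: real ^ 'n. (\<forall>i. 0 \<le> y $ i) \<and> (\<Sum>i\<in>UNIV. y $ i) = 1}"
  have "convex ?S"
    by (auto simp: convex_def sum.distrib simp flip: sum_distrib_left)
  moreover have "range (\<lambda>i. axis i 1) \<subseteq> ?S"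
    by (auto simp: axis_def)
  ultimately have "std_simplex \<subseteq> ?S"
    unfolding std_simplex_def by (intro hull_minimal)
  then show "y \<in> std_simplex \<Longrightarrow> (\<forall>i. 0 \<le> y $ i) \<and> (\<Sum>i\<in>UNIV. y $ i) = 1"
    by auto
next
  assume *: "(\<forall>i. 0 \<le> y $ i) \<and> (\<Sum>i\<in>UNIV. y $ i) = 1"
  have "(\<Sum>i\<in>UNIV. y $ i *\<^sub>R axis i 1) \<in> std_simplex"
    using * unfolding std_simplex_def
    by (intro convex_sum convex_convex_hull) (auto intro: hull_inc)
  also have "(\<Sum>i\<in>UNIV. y $ i *\<^sub>R axis i 1) = y"
    using basis_expansion[of y] by (simp add: scalar_mult_eq_scaleR)
  finally show "y \<in> std_simplex" .
qed

text \<open>Edges are unordered, so the last clause applies in both directions: a tie of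
  \<open>w\<close> along an edge becomes an equation for \<open>y\<close>.\<close>

definition closed_cell :: "'n::finite ugraph \<Rightarrow> real ^ 'n \<Rightarrow> (real ^ 'n) set" where
  "closed_cell G w = {y \<in> std_simplex. (\<forall>i. w $ i = 0 \<longrightarrow> y $ i = 0) \<and>
     (\<forall>i j. {i, j} \<in> edges G \<longrightarrow> w $ i \<le> w $ j \<longrightarrow> y $ i \<le> y $ j)}"

lemma closed_cell_self: "w \<in> std_simplex \<Longrightarrow> w \<in> closed_cell G w"
  by (simp add: closed_cell_def)

lemma closed_cell_subset_simplex: "closed_cell G w \<subseteq> std_simplex"
  by (auto simp: closed_cell_def)

lemma closed_cell_mono: "z \<in> closed_cell G w \<Longrightarrow> closed_cell G z \<subseteq> closed_cell G w"
  by (auto simp: closed_cell_def)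

lemma polytope_std_simplex: "polytope (std_simplex :: (real ^ 'n::finite) set)"
  unfolding std_simplex_def by (rule polytope_convex_hull) simp

lemma polytope_closed_cell:
  fixes w :: "real ^ 'n::finite"
  shows "polytope (closed_cell G w)"
proof -
  define Z where "Z = (\<lambda>i. {y :: real ^ 'n. axis i 1 \<bullet> y = 0}) ` {i. w $ i = 0}"
  define L where "L = (\<lambda>(i, j). {y :: real ^ 'n. (axis i 1 - axis j 1) \<bullet> y \<le> 0}) `
    {(i, j). {i, j} \<in> edges G \<and> w $ i \<le> w $ j}"
  have "\<Inter>Z = {y. \<forall>i. w $ i = 0 \<longrightarrow> y $ i = 0}"
    by (auto simp: Z_def inner_axis')
  moreover have "\<Inter>L = {y. \<forall>i j. {i, j} \<in> edges G \<longrightarrow> w $ i \<le> w $ j \<longrightarrow> y $ i \<le> y $ j}"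
    by (auto simp: L_def inner_diff_left inner_axis')
  ultimately have "closed_cell G w = std_simplex \<inter> \<Inter>(Z \<union> L)"
    by (auto simp: closed_cell_def Inter_Un_distrib)
  moreover have "polyhedron (\<Inter>(Z \<union> L))"
    by (rule polyhedron_Inter) (auto simp: Z_def L_def polyhedron_halfspace_le polyhedron_hyperplane)
  ultimately show ?thesis
    by (simp add: polytope_Int_polyhedron polytope_std_simplex)
qed

lemma convex_closed_cell: "convex (closed_cell G w)"
  by (simp add: polytope_closed_cell polytope_imp_convex)

lemma closed_closed_cell: "closed (closed_cell G w)"
  by (simp add: polytope_closed_cell polytope_imp_closed)

text \<open>A cell depends on \<open>w\<close> only through its zero set and its comparison
  relation, and over a finite index type there are finitely many such pairs.\<close>

lemma finite_closed_cells: "finite (range (closed_cell (G :: 'n::finite ugraph)))"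
proof -
  define c :: "'n set \<times> ('n \<times> 'n) set \<Rightarrow> (real ^ 'n) set" where
    "c = (\<lambda>(Z, L). {y \<in> std_simplex. (\<forall>i\<in>Z. y $ i = 0) \<and>
       (\<forall>i j. {i, j} \<in> edges G \<longrightarrow> (i, j) \<in> L \<longrightarrow> y $ i \<le> y $ j)})"
  have "closed_cell G w = c ({i. w $ i = 0}, {(i, j). w $ i \<le> w $ j})" for w
    by (simp add: closed_cell_def c_def)
  then have "range (closed_cell G) \<subseteq> range c" by auto
  then show ?thesis by (rule finite_subset) simp
qed

text \<open>On the cell of \<open>w\<close>, each constraint coming from \<open>z\<close> either
  holds already or is the equality case of a valid inequality: \<open>z $ i = 0\<close> asks for
  equality in \<open>0 \<le> y $ i\<close>, and \<open>z $ i \<le> z $ j\<close> with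
  \<open>w $ j < w $ i\<close> asks for equality in \<open>y $ j \<le> y $ i\<close>. The point
  \<open>z\<close> is arbitrary, so this covers intersections of any two cells.\<close>

lemma closed_cell_Int_face_of: "closed_cell G z \<inter> closed_cell G w face_of closed_cell G w"
  unfolding face_of_def
proof (intro conjI ballI impI)
  show "closed_cell G z \<inter> closed_cell G w \<subseteq> closed_cell G w" by simp
  show "convex (closed_cell G z \<inter> closed_cell G w)"
    by (intro convex_Int convex_closed_cell)
  fix a b p
  assume a: "a \<in> closed_cell G w" and b: "b \<in> closed_cell G w"
    and p: "p \<in> closed_cell G z \<inter> closed_cell G w" and "p \<in> open_segment a b"
  then obtain u where u: "0 < u" "u < 1" "p = (1 - u) *\<^sub>R a + u *\<^sub>R b"
    by (auto simp: in_segment)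
  have p_nth: "p $ i = (1 - u) * a $ i + u * b $ i" for i by (simp add: u)
  have nonneg: "0 \<le> a $ i" "0 \<le> b $ i" for i
    using a b by (auto simp: closed_cell_def mem_std_simplex_iff)
  have zero: "a $ i = 0 \<and> b $ i = 0" if "z $ i = 0" for i
  proof -
    have "p $ i = 0" using p that by (auto simp: closed_cell_def)
    then show ?thesis
      using nonneg[of i] u p_nth[of i] add_nonneg_eq_0_iff[of "(1 - u) * a $ i" "u * b $ i"] by auto
  qed
  have le: "a $ i \<le> a $ j \<and> b $ i \<le> b $ j" if e: "{i, j} \<in> edges G" "z $ i \<le> z $ j" for i j
  proof (cases "w $ i \<le> w $ j")
    case True
    then show ?thesis using a b e by (auto simp: closed_cell_def)
  next
    case False
    moreover have "{j, i} \<in> edges G" using e by (simp add: insert_commute)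
    ultimately have ge: "a $ j \<le> a $ i" "b $ j \<le> b $ i" using a b by (auto simp: closed_cell_def)
    have "p $ i \<le> p $ j" using p e by (auto simp: closed_cell_def)
    then have "(1 - u) * (a $ i - a $ j) + u * (b $ i - b $ j) \<le> 0"
      by (simp add: p_nth algebra_simps)
    moreover have "(1 - u) * (a $ i - a $ j) \<ge> 0" "u * (b $ i - b $ j) \<ge> 0" using u ge by auto
    ultimately have "(1 - u) * (a $ i - a $ j) = 0" "u * (b $ i - b $ j) = 0" by linarith+
    then show ?thesis using u by auto
  qed
  show "a \<in> closed_cell G z \<inter> closed_cell G w" "b \<in> closed_cell G z \<inter> closed_cell G w"
    using a b zero le by (auto simp: closed_cell_def)
qed

lemma closed_cell_face_of: "z \<in> closed_cell G w \<Longrightarrow> closed_cell G z face_of closed_cell G w"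
  using closed_cell_Int_face_of[of G z w] closed_cell_mono[of z G w] by (simp add: Int_absorb2)

text \<open>Strict inequalities survive a small step along \<open>d\<close>, and the hypotheses make
  \<open>d\<close> respect the equations. Ties at height zero are handled by
  \<open>zero\<close>.\<close>

lemma closed_cell_perturb:
  fixes z d :: "real ^ 'n::finite"
  assumes z: "z \<in> std_simplex" and sum0: "(\<Sum>i\<in>UNIV. d $ i) = 0"
    and zero: "\<And>i. z $ i = 0 \<Longrightarrow> d $ i = 0"
    and tie: "\<And>i j. {i, j} \<in> edges G \<Longrightarrow> z $ i = z $ j \<Longrightarrow> z $ i \<noteq> 0 \<Longrightarrow> d $ i = d $ j"
  obtains e where "e > 0" "z + e *\<^sub>R d \<in> closed_cell G z"
proof -
  have nonneg: "0 \<le> z $ i" for i using z by (simp add: mem_std_simplex_iff)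
  have lim: "((\<lambda>e. z $ i + e * d $ i) \<longlongrightarrow> z $ i) (at_right 0)" for i
    by (auto intro!: tendsto_eq_intros)
  have "eventually (\<lambda>e. 0 \<le> z $ i + e * d $ i) (at_right 0)" for i
  proof (cases "z $ i = 0")
    case False
    then have "0 < z $ i" using nonneg[of i] by simp
    then show ?thesis
      using order_tendstoD(1)[OF lim, of 0 i] by (auto elim: eventually_mono)
  qed (simp add: zero)
  moreover have "eventually (\<lambda>e. {i, j} \<in> edges G \<longrightarrow> z $ i \<le> z $ j \<longrightarrow>
      z $ i + e * d $ i \<le> z $ j + e * d $ j) (at_right 0)" for i j
  proof (cases "z $ i < z $ j")
    case True
    then show ?thesis
      using order_tendstoD(1)[OF tendsto_diff[OF lim[of j] lim[of i]], of 0] by (auto elim: eventually_mono)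
  next
    case False
    have "d $ i = d $ j" if "{i, j} \<in> edges G" "z $ i \<le> z $ j"
      using False that tie[of i j] zero[of i] zero[of j] by (cases "z $ i = 0") auto
    then show ?thesis by auto
  qed
  ultimately have "eventually (\<lambda>e. 0 < e \<and> (\<forall>i. 0 \<le> z $ i + e * d $ i) \<and> (\<forall>i j. {i, j} \<in> edges G \<longrightarrow>
      z $ i \<le> z $ j \<longrightarrow> z $ i + e * d $ i \<le> z $ j + e * d $ j)) (at_right 0)"
    by (auto intro!: eventually_conj eventually_all_finite eventually_at_right_less)
  then obtain e where e: "0 < e" "\<forall>i. 0 \<le> z $ i + e * d $ i"
    "\<forall>i j. {i, j} \<in> edges G \<longrightarrow> z $ i \<le> z $ j \<longrightarrow> z $ i + e * d $ i \<le> z $ j + e * d $ j"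
    by (auto dest!: eventually_happens simp: trivial_limit_at_right_real)
  have "z + e *\<^sub>R d \<in> closed_cell G z"
    using e z sum0 zero
    by (auto simp: closed_cell_def mem_std_simplex_iff sum.distrib simp flip: sum_distrib_left)
  then show ?thesis using that e by blast
qed

text \<open>Prolongation criterion: every segment from a point \<open>y\<close> of the cell to
  \<open>z\<close> must extend beyond \<open>z\<close> within the cell. The direction
  \<open>z - y\<close> is admissible for \<open>closed_cell_perturb\<close> because \<open>y\<close>
  satisfies every equation that \<open>z\<close> satisfies.\<close>

lemma rel_interior_closed_cell_self:
  assumes z: "z \<in> std_simplex"
  shows "z \<in> rel_interior (closed_cell G z)"
proof -
  have "\<exists>e>1. (1 - e) *\<^sub>R y + e *\<^sub>R z \<in> closed_cell G z" if y: "y \<in> closed_cell G z" for y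
  proof -
    have eq: "y $ i = y $ j" if "{i, j} \<in> edges G" "z $ i = z $ j" for i j
    proof -
      have "{j, i} \<in> edges G" using that by (simp add: insert_commute)
      then show ?thesis using y that by (intro antisym) (auto simp: closed_cell_def)
    qed
    obtain e where "e > 0" "z + e *\<^sub>R (z - y) \<in> closed_cell G z"
      by (rule closed_cell_perturb[OF z, of "z - y" G])
         (use y z eq in \<open>auto simp: closed_cell_def mem_std_simplex_iff sum_subtractf\<close>)
    \<comment> \<open>The criterion wants a factor above 1: \<open>1 + e\<close> turns its affine
      combination into \<open>z + e *\<^sub>R (z - y)\<close>.\<close>
    then show ?thesis
      by (intro exI[of _ "1 + e"]) (simp add: algebra_simps)
  qed
  then show ?thesis
    using closed_cell_self[OF z] by (subst convex_rel_interior_iff) (auto simp: convex_closed_cell)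
qed

text \<open>For \<open>z\<close> in the relative interior of a face \<open>F\<close>, both
  \<open>F\<close> and the cell of \<open>z\<close> are faces of the same polytope, and
  \<open>z\<close> is relatively interior to both. A face meeting the relative interior of a subset
  contains that subset, so the two coincide.\<close>

lemma face_of_closed_cell_iff:
  "F face_of closed_cell G w \<longleftrightarrow> F = {} \<or> (\<exists>z\<in>closed_cell G w. F = closed_cell G z)"
proof
  assume F: "F face_of closed_cell G w"
  show "F = {} \<or> (\<exists>z\<in>closed_cell G w. F = closed_cell G z)"
  proof (cases "F = {}")
    case False
    then obtain z where z: "z \<in> rel_interior F"
      using F face_of_imp_convex rel_interior_eq_empty by blast
    have zF: "z \<in> F" using z rel_interior_subset by blast
    then have zw: "z \<in> closed_cell G w" using F face_of_imp_subset by blast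
    then have zs: "z \<in> std_simplex" using closed_cell_subset_simplex by blast
    have "F \<subseteq> closed_cell G z"
      by (rule subset_of_face_of[OF closed_cell_face_of[OF zw] face_of_imp_subset[OF F]])
         (use z closed_cell_self[OF zs] in blast)
    moreover have "closed_cell G z \<subseteq> F"
      by (rule subset_of_face_of[OF F closed_cell_mono[OF zw]])
         (use zF rel_interior_closed_cell_self[OF zs] in blast)
    ultimately show ?thesis using zw by blast
  qed simp
qed (auto intro: closed_cell_face_of)

section \<open>Regions of the graphical arrangement\<close>

text \<open>The set \<open>?C\<close> given by the strict inequalities of \<open>p\<close> is convex
  and misses all hyperplanes, so it lies in the component \<open>R\<close> of
  \<open>p\<close>.\<close>

lemma arrangement_region_eq:
  fixes p :: "real ^ 'n::finite"
  assumes R: "R \<in> arrangement_regions (graphical_arrangement G)" and p: "p \<in> R"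
  shows "R = {y. \<forall>i j. {i, j} \<in> edges G \<longrightarrow> p $ i < p $ j \<longrightarrow> y $ i < y $ j}" (is "_ = ?C")
    and "\<And>i j. {i, j} \<in> edges G \<Longrightarrow> p $ i \<noteq> p $ j"
proof -
  have RU: "R \<subseteq> - \<Union>(graphical_arrangement G)" and conn: "connected R"
    using R by (auto simp: arrangement_regions_def dest: in_components_subset in_components_connected)
  have ne: "y $ i \<noteq> y $ j" if "y \<in> R" "{i, j} \<in> edges G" for y i j
  proof -
    have "{x. x $ i = x $ j} \<in> graphical_arrangement G"
      using that by (auto simp: graphical_arrangement_def)
    then show ?thesis using RU that by blast
  qed
  show "\<And>i j. {i, j} \<in> edges G \<Longrightarrow> p $ i \<noteq> p $ j" using ne p by blast
  have "?C = (\<Inter>(i, j)\<in>{(i, j). {i, j} \<in> edges G \<and> p $ i < p $ j}. {y. (axis i 1 - axis j 1) \<bullet> y < 0})"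
    by (auto simp: inner_diff_left inner_axis')
  also have "convex \<dots>"
    by (intro convex_INT) (auto simp: convex_halfspace_lt)
  finally have "connected ?C" by (rule convex_connected)
  moreover have "?C \<subseteq> - \<Union>(graphical_arrangement G)"
  proof
    fix y assume y: "y \<in> ?C"
    have "y $ i \<noteq> y $ j" if e: "{i, j} \<in> edges G" for i j
    proof -
      have e': "{j, i} \<in> edges G" using e by (simp add: insert_commute)
      have "p $ i < p $ j \<Longrightarrow> y $ i < y $ j" "p $ j < p $ i \<Longrightarrow> y $ j < y $ i"
        using y e e' by simp_all
      then show ?thesis using ne[OF p e] by argo
    qed
    then show "y \<in> - \<Union>(graphical_arrangement G)" by (auto simp: graphical_arrangement_def)
  qed
  moreover have "R \<inter> ?C \<noteq> {}" using p by auto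
  ultimately have "?C \<subseteq> R"
    using components_maximal[OF R[unfolded arrangement_regions_def]] by blast
  \<comment> \<open>A point of \<open>R\<close> violating one of the inequalities would, by the
    intermediate value theorem on the connected set \<open>R\<close>, yield a point of
    \<open>R\<close> on a hyperplane.\<close>
  moreover have "R \<subseteq> ?C"
  proof clarify
    fix y i j assume y: "y \<in> R" and e: "{i, j} \<in> edges G" and lt: "p $ i < p $ j"
    show "y $ i < y $ j"
    proof (rule ccontr)
      assume "\<not> y $ i < y $ j"
      then have "(axis i 1 - axis j 1) \<bullet> p \<le> 0" "0 \<le> (axis i 1 - axis j 1) \<bullet> y"
        using lt by (auto simp: inner_diff_left inner_axis')
      then obtain q where "q \<in> R" "(axis i 1 - axis j 1) \<bullet> q = 0"
        using connected_ivt_hyperplane[OF conn p y] by blast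
      then show False using ne[of q i j] e by (simp add: inner_diff_left inner_axis')
    qed
  qed
  ultimately show "R = ?C" by blast
qed

lemma closure_arrangement_region:
  fixes p :: "real ^ 'n::finite"
  assumes R: "R \<in> arrangement_regions (graphical_arrangement G)" and p: "p \<in> R"
  shows "closure R = {y. \<forall>i j. {i, j} \<in> edges G \<longrightarrow> p $ i < p $ j \<longrightarrow> y $ i \<le> y $ j}" (is "_ = ?C")
proof
  have "?C = (\<Inter>(i, j)\<in>{(i, j). {i, j} \<in> edges G \<and> p $ i < p $ j}. {y. (axis i 1 - axis j 1) \<bullet> y \<le> 0})"
    by (auto simp: inner_diff_left inner_axis')
  also have "closed \<dots>"
    by (intro closed_INT) (auto simp: closed_halfspace_le)
  finally have "closed ?C" .
  moreover have "R \<subseteq> ?C" using arrangement_region_eq(1)[OF assms] by fastforce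
  ultimately show "closure R \<subseteq> ?C" by (rule closure_minimal[rotated])
  show "?C \<subseteq> closure R"
  proof
    fix y assume y: "y \<in> ?C"
    \<comment> \<open>Moving from \<open>y\<close> slightly towards \<open>p\<close> makes the weak
      inequalities strict; letting \<open>e\<close> tend to 0 exhibits \<open>y\<close> as a limit
      of points of \<open>R\<close>.\<close>
    have "y + e *\<^sub>R (p - y) \<in> R" if e: "0 < e" "e < 1" for e
    proof (subst arrangement_region_eq(1)[OF assms], clarify)
      fix i j assume ij: "{i, j} \<in> edges G" "p $ i < p $ j"
      have "(1 - e) * y $ i \<le> (1 - e) * y $ j" "e * p $ i < e * p $ j"
        using y ij e by (auto intro: mult_left_mono)
      then show "(y + e *\<^sub>R (p - y)) $ i < (y + e *\<^sub>R (p - y)) $ j"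
        by (simp add: algebra_simps)
    qed
    then have "eventually (\<lambda>e. y + e *\<^sub>R (p - y) \<in> R) (at_right 0)"
      by (auto simp: eventually_at_right_field intro!: exI[of _ 1])
    moreover have "((\<lambda>e. y + e *\<^sub>R (p - y)) \<longlongrightarrow> y) (at_right 0)"
      by (auto intro!: tendsto_eq_intros)
    ultimately show "y \<in> closure R"
      by (intro Lim_in_closed_set[OF closed_closure])
         (auto elim!: eventually_mono intro: closure_subset[THEN subsetD] simp: trivial_limit_at_right_real)
  qed
qed

text \<open>A point \<open>p\<close> of the region is shifted and scaled to a strictly positive
  point \<open>w\<close> of the simplex. Positivity makes the zero clause of
  \<open>closed_cell\<close> vacuous, and as \<open>p\<close> has no ties along edges, strict and
  weak comparisons agree there.\<close>

lemma simplex_Int_closure_region: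
  fixes G :: "'n::finite ugraph"
  assumes R: "R \<in> arrangement_regions (graphical_arrangement G)"
  obtains w where "w \<in> std_simplex" "std_simplex \<inter> closure R = closed_cell G w"
proof -
  obtain p where p: "p \<in> R"
    using R in_components_nonempty unfolding arrangement_regions_def by blast
  \<comment> \<open>The shift raises the least coordinate to 1, so the normalising sum
    \<open>s\<close> is positive.\<close>
  define c where "c = 1 - Min (range (($) p))"
  define s where "s = (\<Sum>i\<in>UNIV. p $ i + c)"
  define w :: "real ^ 'n" where "w = (\<chi> i. (p $ i + c) / s)"
  have pos: "0 < p $ i + c" for i
  proof -
    have "Min (range (($) p)) \<le> p $ i" by (rule Min_le) auto
    then show ?thesis unfolding c_def by linarith
  qed
  have s: "0 < s" unfolding s_def by (rule sum_pos) (use pos in auto)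
  have w_pos: "0 < w $ i" for i using pos s by (simp add: w_def)
  have "w \<in> std_simplex"
    using w_pos s by (auto simp: mem_std_simplex_iff less_imp_le)
      (simp add: w_def s_def flip: sum_divide_distrib)
  moreover have "w $ i \<le> w $ j \<longleftrightarrow> p $ i < p $ j" if "{i, j} \<in> edges G" for i j
    using arrangement_region_eq(2)[OF R p that] s by (auto simp: w_def divide_le_cancel)
  then have "std_simplex \<inter> closure R = closed_cell G w"
    using w_pos by (auto simp: closure_arrangement_region[OF R p] closed_cell_def less_imp_neq[THEN not_sym])
  ultimately show ?thesis by (rule that)
qed

text \<open>Adding a small multiple of an injective vertex numbering breaks all ties of
  \<open>z\<close> and keeps its strict inequalities, so the region of the perturbed point has
  \<open>z\<close> in its closure.\<close>

lemma mem_closure_arrangement_region: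
  fixes z :: "real ^ 'n::finite"
  assumes G: "simple_graph G"
  obtains R where "R \<in> arrangement_regions (graphical_arrangement G)" "z \<in> closure R"
proof -
  obtain g :: "'n \<Rightarrow> nat" where g: "inj g"
    using finite_imp_inj_to_nat_seg[OF finite, of UNIV] by blast
  define q where "q e i = z $ i + e * real (g i)" for e i
  have lim: "((\<lambda>e. q e i) \<longlongrightarrow> z $ i) (at_right 0)" for i
    unfolding q_def by (auto intro!: tendsto_eq_intros)
  have "eventually (\<lambda>e. z $ i < z $ j \<longrightarrow> q e i < q e j) (at_right 0)" for i j
    using order_tendstoD(1)[OF tendsto_diff[OF lim[of j] lim[of i]], of 0]
    by (cases "z $ i < z $ j") (auto elim: eventually_mono)
  then have "eventually (\<lambda>e. 0 < e \<and> (\<forall>i j. z $ i < z $ j \<longrightarrow> q e i < q e j)) (at_right 0)"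
    by (auto intro!: eventually_conj eventually_all_finite eventually_at_right_less)
  then obtain e where e: "0 < e" "\<And>i j. z $ i < z $ j \<Longrightarrow> q e i < q e j"
    by (auto dest!: eventually_happens simp: trivial_limit_at_right_real)
  define p :: "real ^ 'n" where "p = (\<chi> i. q e i)"
  have ne: "p $ i \<noteq> p $ j" if "i \<noteq> j" for i j
  proof (cases "z $ i = z $ j")
    case True
    then show ?thesis using e(1) that g by (auto simp: p_def q_def inj_eq)
  next
    case False
    then show ?thesis using e(2)[of i j] e(2)[of j i] by (auto simp: p_def neq_iff)
  qed
  have "i \<noteq> j" if "{i, j} \<in> edges G" for i j
    using G that by (auto simp: simple_graph_def)
  then have "p \<in> - \<Union>(graphical_arrangement G)"
    using ne by (auto simp: graphical_arrangement_def)
  then obtain R where R: "R \<in> arrangement_regions (graphical_arrangement G)" "p \<in> R"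
    unfolding arrangement_regions_def
    by (metis UnionE Union_components)
  moreover have "z $ i \<le> z $ j" if "p $ i < p $ j" for i j
    using e(2)[of j i] that by (force simp: p_def)
  then have "z \<in> closure R" by (simp add: closure_arrangement_region[OF R])
  ultimately show ?thesis using that by blast
qed

section \<open>The graphical complex as the set of closed cells\<close>

lemma std_simplex_nonempty: "std_simplex \<noteq> ({} :: (real ^ 'n::finite) set)"
  by (simp add: std_simplex_def)

text \<open>Traces of closed regions are cells, so their faces are cells or empty. Conversely, each
  \<open>z\<close> lies in the closure of a region, and its cell is a face of that trace.\<close>

lemma graphical_complex_eq:
  assumes G: "simple_graph G"
  shows "graphical_complex G = insert {} (closed_cell G ` std_simplex)"
proof
  show "graphical_complex G \<subseteq> insert {} (closed_cell G ` std_simplex)"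
  proof
    fix F assume "F \<in> graphical_complex G"
    then obtain R where R: "R \<in> arrangement_regions (graphical_arrangement G)"
      and F: "F face_of (std_simplex \<inter> closure R)"
      by (auto simp: graphical_complex_def)
    obtain w where "std_simplex \<inter> closure R = closed_cell G w"
      using simplex_Int_closure_region[OF R] by blast
    then show "F \<in> insert {} (closed_cell G ` std_simplex)"
      using F closed_cell_subset_simplex by (auto simp: face_of_closed_cell_iff)
  qed
  \<comment> \<open>The empty face is carried along because it requires some region to exist, which
    any point \<open>z\<close> of the simplex provides.\<close>
  have "closed_cell G z \<in> graphical_complex G \<and> {} \<in> graphical_complex G" if z: "z \<in> std_simplex" for z
  proof -
    obtain R where R: "R \<in> arrangement_regions (graphical_arrangement G)" and zR: "z \<in> closure R"
      using mem_closure_arrangement_region[OF G] by blast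
    obtain w where w: "std_simplex \<inter> closure R = closed_cell G w"
      using simplex_Int_closure_region[OF R] by blast
    then have "z \<in> closed_cell G w" using z zR by blast
    then have "closed_cell G z face_of (std_simplex \<inter> closure R)"
      unfolding w by (rule closed_cell_face_of)
    then show ?thesis using R by (auto simp: graphical_complex_def)
  qed
  then show "insert {} (closed_cell G ` std_simplex) \<subseteq> graphical_complex G"
    using std_simplex_nonempty by blast
qed

lemma polytopal_complex_graphical_complex:
  assumes G: "simple_graph G"
  shows "polytopal_complex (graphical_complex G)"
  unfolding polytopal_complex_def graphical_complex_eq[OF G]
proof (intro conjI ballI allI impI)
  show "finite (insert {} (closed_cell G ` std_simplex))"
    using finite_subset[OF image_mono finite_closed_cells] by blast
next
  fix P assume P: "P \<in> insert {} (closed_cell G ` std_simplex)"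
  show "polytope P" using P polytope_closed_cell polytope_empty by auto
  show "F \<in> insert {} (closed_cell G ` std_simplex)" if "F face_of P" for F
    using P that closed_cell_subset_simplex by (auto simp: face_of_closed_cell_iff) blast
  fix Q assume Q: "Q \<in> insert {} (closed_cell G ` std_simplex)"
  have "A \<inter> B face_of B" if "A \<in> insert {} (closed_cell G ` std_simplex)"
    "B \<in> insert {} (closed_cell G ` std_simplex)" for A B
    using that closed_cell_Int_face_of by auto
  from this[OF P Q] this[OF Q P] show "P \<inter> Q face_of P" "P \<inter> Q face_of Q"
    by (simp_all add: Int_commute)
qed

lemma open_cells_graphical_complex:
  assumes "simple_graph G"
  shows "open_cells (graphical_complex G) = (\<lambda>w. rel_interior (closed_cell G w)) ` std_simplex"
  using closed_cell_self by (fastforce simp: open_cells_def graphical_complex_eq[OF assms])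

lemma closure_rel_interior_closed_cell: "closure (rel_interior (closed_cell G w)) = closed_cell G w"
  by (simp add: convex_closure_rel_interior convex_closed_cell closed_closed_cell)

section \<open>Orientations induced by vertex weights\<close>

lemma simple_graph_edgeE:
  assumes "simple_graph H" "e \<in> edges H"
  obtains u v where "e = {u, v}" "u \<noteq> v" "u \<in> verts H" "v \<in> verts H"
  using assms by (auto simp: simple_graph_def card_2_iff)

text \<open>Arcs run from larger to smaller weight. An edge is an unordered set, so
  \<open>SOME\<close> selects the unique endpoint order with decreasing weight; the restriction to
  \<open>edges H\<close> gives the extensionality demanded by \<open>orientation\<close>.\<close>

definition weight_orientation :: "'a ugraph \<Rightarrow> ('a \<Rightarrow> 'b::linorder) \<Rightarrow> 'a set \<Rightarrow> 'a oriented_edge" where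
  "weight_orientation H f = (\<lambda>e\<in>edges H.
     if \<exists>u v. e = {u, v} \<and> f v < f u
     then (SOME d. \<exists>u v. d = Directed u v \<and> e = {u, v} \<and> f v < f u)
     else Undirected e)"

lemma weight_orientation_tie:
  "{u, v} \<in> edges H \<Longrightarrow> f u = f v \<Longrightarrow> weight_orientation H f {u, v} = Undirected {u, v}"
  by (auto simp: weight_orientation_def doubleton_eq_iff)

lemma weight_orientation_less:
  assumes "{u, v} \<in> edges H" "f v < f u"
  shows "weight_orientation H f {u, v} = Directed u v"
proof -
  have "(SOME d. \<exists>x y. d = Directed x y \<and> {u, v} = {x, y} \<and> f y < f x) = Directed u v"
    using assms(2) by (intro some_equality) (auto simp: doubleton_eq_iff)
  then show ?thesis using assms by (auto simp: weight_orientation_def)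
qed

lemma weight_orientation_cases:
  assumes "{u, v} \<in> edges H"
  obtains "f u = f v" "weight_orientation H f {u, v} = Undirected {u, v}"
  | "f v < f u" "weight_orientation H f {u, v} = Directed u v"
  | "f u < f v" "weight_orientation H f {u, v} = Directed v u"
proof -
  have "{v, u} \<in> edges H" using assms by (simp add: insert_commute)
  then show ?thesis
    using that assms weight_orientation_tie[of u v H f] weight_orientation_less[of u v H f]
      weight_orientation_less[of v u H f]
    by (metis insert_commute linorder_less_linear)
qed

lemma orientation_weight_orientation:
  assumes "\<And>e. e \<in> edges H \<Longrightarrow> \<exists>u v. e = {u, v}"
  shows "orientation H (weight_orientation H f)"
  unfolding orientation_def
proof (rule PiE_I)
  fix e assume e: "e \<in> edges H"
  then obtain u v where uv: "e = {u, v}" using assms by blast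
  with e have "{u, v} \<in> edges H" by simp
  then show "weight_orientation H f e \<in> insert (Undirected e) {Directed u v |u v. e = {u, v}}"
    by (cases rule: weight_orientation_cases[where f = f]) (auto simp: uv)
qed (simp add: weight_orientation_def)

lemma orientation_eq_weight_orientation:
  assumes H: "simple_graph H" and "orientation H \<omega>"
    and tie: "\<And>u v. {u, v} \<in> edges H \<Longrightarrow> f u = f v \<Longrightarrow> \<omega> {u, v} = Undirected {u, v}"
    and less: "\<And>u v. {u, v} \<in> edges H \<Longrightarrow> f v < f u \<Longrightarrow> \<omega> {u, v} = Directed u v"
  shows "\<omega> = weight_orientation H f"
proof (rule PiE_ext)
  have "orientation H (weight_orientation H f)"
    using H by (intro orientation_weight_orientation) (metis simple_graph_edgeE)
  then show "weight_orientation H f \<in> (\<Pi>\<^sub>E e\<in>edges H. insert (Undirected e) {Directed u v | u v. e = {u, v}})"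
    by (simp add: orientation_def)
  show "\<omega> \<in> (\<Pi>\<^sub>E e\<in>edges H. insert (Undirected e) {Directed u v | u v. e = {u, v}})"
    using \<open>orientation H \<omega>\<close> by (simp add: orientation_def)
  fix e assume e: "e \<in> edges H"
  then obtain u v where uv: "e = {u, v}" using H by (metis simple_graph_edgeE)
  with e have "{u, v} \<in> edges H" "{v, u} \<in> edges H" by (auto simp: insert_commute)
  then show "\<omega> e = weight_orientation H f e"
    by (cases rule: weight_orientation_cases[where f = f])
       (use tie[of u v] less[of u v] less[of v u] in \<open>auto simp: uv insert_commute\<close>)
qed

text \<open>Weights strictly decrease along arcs, hence along directed paths, which excludes
  cycles.\<close>

lemma acyclic_weight_orientation:
  assumes edge: "\<And>e. e \<in> edges H \<Longrightarrow> \<exists>u v. e = {u, v}"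
    and ne: "\<And>u v. {u, v} \<in> edges H \<Longrightarrow> f u \<noteq> f v"
  shows "acyclic_orientation H (weight_orientation H f)"
proof -
  have arc: "f v < f u" if arc: "(u, v) \<in> arcs H (weight_orientation H f)" for u v
  proof -
    obtain e where e: "e \<in> edges H" "weight_orientation H f e = Directed u v"
      using arc by (auto simp: arcs_def)
    then obtain x y where xy: "e = {x, y}" using edge by blast
    with e have "{x, y} \<in> edges H" by simp
    then show ?thesis
      by (cases rule: weight_orientation_cases[where f = f]) (use e xy in auto)
  qed
  have "f v < f u" if "(u, v) \<in> (arcs H (weight_orientation H f))\<^sup>+" for u v
    using that by (induction rule: trancl_induct) (auto dest: arc)
  then have "acyclic (arcs H (weight_orientation H f))"
    unfolding acyclic_def by blast
  moreover have "weight_orientation H f e \<noteq> Undirected e" if e: "e \<in> edges H" for e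
  proof -
    obtain u v where uv: "e = {u, v}" using edge e by blast
    with e have "{u, v} \<in> edges H" by simp
    then show ?thesis
      by (cases rule: weight_orientation_cases[where f = f]) (use ne \<open>{u, v} \<in> edges H\<close> uv in auto)
  qed
  ultimately show ?thesis
    using orientation_weight_orientation[OF edge] by (auto simp: acyclic_orientation_def)
qed

text \<open>The witnessing blocks are the connected components of the graph of tied edges; the
  weight is constant on each block and orients the quotient.\<close>

lemma pao_weight_orientation:
  fixes f :: "'a \<Rightarrow> 'b::linorder"
  assumes H: "simple_graph H"
  shows "pao H (weight_orientation H f)"
proof -
  define T where "T = {(x, y). {x, y} \<in> edges H \<and> f x = f y}"
  \<comment> \<open>\<open>T\<^sup>*\<close> is reflexive on the whole type, so it is cut down to an
    equivalence relation on the vertices.\<close>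
  define r where "r = T\<^sup>* \<inter> verts H \<times> verts H"
  define \<Sigma> where "\<Sigma> = verts H // r"
  \<comment> \<open>Any representative serves, because the weight is constant on a block
    (\<open>g_eq\<close>).\<close>
  define g where "g A = f (SOME u. u \<in> A)" for A
  define \<pi> where "\<pi> = weight_orientation (partition_graph H \<Sigma>) g"
  have "sym T" by (auto simp: T_def sym_def insert_commute)
  then have symT: "sym (T\<^sup>*)" by (rule sym_rtrancl)
  have TV: "x \<in> verts H \<and> y \<in> verts H" if "(x, y) \<in> T" for x y
    using that H by (auto simp: T_def simple_graph_def)
  have "equiv (verts H) r"
  proof (rule equivI)
    show "refl_on (verts H) r" by (auto simp: r_def refl_on_def)
    show "sym r" using symT by (auto simp: r_def sym_def)
    show "trans r" by (auto simp: r_def intro!: transI)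
  qed (auto simp: r_def)
  then have part: "partition_on (verts H) \<Sigma>"
    unfolding \<Sigma>_def by (rule partition_on_quotient)
  have r_f: "f x = f y" if "(x, y) \<in> r" for x y
  proof -
    have "(x, y) \<in> T\<^sup>*" using that by (simp add: r_def)
    then show ?thesis by (induction rule: rtrancl_induct) (auto simp: T_def)
  qed
  have block: "A = r `` {u} \<and> (u, v) \<in> r" if "A \<in> \<Sigma>" "u \<in> A" "v \<in> A" for A u v
    using that \<open>equiv (verts H) r\<close> quotient_eq_iff[OF \<open>equiv (verts H) r\<close>]
    by (metis Image_singleton_iff \<Sigma>_def equiv_class_eq quotientE)
  have g_eq: "g A = f u" if "A \<in> \<Sigma>" "u \<in> A" for A u
    unfolding g_def using r_f block that by (metis someI)
  have same: "A = B" if "A \<in> \<Sigma>" "B \<in> \<Sigma>" "u \<in> A" "v \<in> B" "{u, v} \<in> edges H" "f u = f v" for A B u v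
  proof -
    have "(u, v) \<in> r" using TV[of u v] that by (auto simp: r_def T_def)
    then show ?thesis
      using that \<open>equiv (verts H) r\<close> quotient_eq_iff[of "verts H" r A B u v] by (simp add: \<Sigma>_def)
  qed
  have conn: "connected_graph (induced_subgraph H A)" if A: "A \<in> \<Sigma>" for A
  proof -
    have "A \<noteq> {}" using part A by (auto simp: partition_on_def)
    \<comment> \<open>A path of tied edges starting at \<open>u\<close> never leaves the class of
      \<open>u\<close>, so it runs inside the block.\<close>
    moreover have "(u, v) \<in> {(x, y). {x, y} \<in> edges H \<and> {x, y} \<subseteq> A}\<^sup>*" if uv: "u \<in> A" "v \<in> A" for u v
    proof -
      have Au: "A = r `` {u}" and "(u, v) \<in> T\<^sup>*" using block[OF A uv] by (auto simp: r_def)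
      have u: "u \<in> verts H" using part A uv by (auto simp: partition_on_def)
      from \<open>(u, v) \<in> T\<^sup>*\<close> show ?thesis
      proof (induction rule: rtrancl_induct)
        case (step x y)
        have "x \<in> A" "y \<in> A"
          using step u TV[OF step(2)] by (auto simp: Au r_def intro: rtrancl_into_rtrancl)
        then have "(x, y) \<in> {(x, y). {x, y} \<in> edges H \<and> {x, y} \<subseteq> A}"
          using step(2) by (auto simp: T_def)
        then show ?case by (rule rtrancl_into_rtrancl[OF step.IH])
      qed simp
    qed
    ultimately show ?thesis by (auto simp: connected_graph_def induced_subgraph_def)
  qed
  have "acyclic_orientation (partition_graph H \<Sigma>) \<pi>"
    unfolding \<pi>_def
  proof (rule acyclic_weight_orientation)
    show "\<exists>A B. e = {A, B}" if "e \<in> edges (partition_graph H \<Sigma>)" for e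
      using that by (auto simp: partition_graph_def)
    \<comment> \<open>By \<open>same\<close>, a tied edge has both ends in one block, so blocks
      joined by an edge have different weights.\<close>
    show "g A \<noteq> g B" if AB: "{A, B} \<in> edges (partition_graph H \<Sigma>)" for A B
    proof -
      obtain C D u v where CD: "{A, B} = {C, D}" "C \<in> \<Sigma>" "D \<in> \<Sigma>" "C \<noteq> D" "u \<in> C" "v \<in> D"
        "{u, v} \<in> edges H"
        using AB by (auto simp: partition_graph_def)
      then have "g C \<noteq> g D" using same[of C D u v] g_eq[of C u] g_eq[of D v] by auto
      then show ?thesis using CD(1) by (auto simp: doubleton_eq_iff)
    qed
  qed
  moreover have "weight_orientation H f {u, v} = Undirected {u, v}"
    if "A \<in> \<Sigma>" "u \<in> A" "v \<in> A" "{u, v} \<in> edges H" for A u v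
    using that r_f block by (metis weight_orientation_tie)
  moreover have "weight_orientation H f {u, v} = Directed u v"
    if "A \<in> \<Sigma>" "B \<in> \<Sigma>" "A \<noteq> B" "u \<in> A" "v \<in> B" "{u, v} \<in> edges H" "\<pi> {A, B} = Directed A B" for A B u v
  proof -
    have "{A, B} \<in> edges (partition_graph H \<Sigma>)"
      using that by (auto simp: partition_graph_def)
    then have "g B < g A"
      by (cases rule: weight_orientation_cases[where f = g]) (use that in \<open>auto simp: \<pi>_def\<close>)
    then show ?thesis using that by (simp add: g_eq weight_orientation_less)
  qed
  ultimately have "pao_witness H (weight_orientation H f) \<Sigma> \<pi>"
    unfolding pao_witness_def connected_partition_def using part conn
    by (intro conjI ballI impI) simp_all
  moreover have "orientation H (weight_orientation H f)"
    using H by (intro orientation_weight_orientation) (metis simple_graph_edgeE)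
  ultimately show ?thesis by (auto simp: pao_def)
qed

section \<open>Order ideals and topological sorting of a partial acyclic orientation\<close>

lemma pao_witness_arcs_iff:
  assumes w: "pao_witness H \<omega> \<Sigma> \<pi>"
  shows "(A, B) \<in> arcs (partition_graph H \<Sigma>) \<pi> \<longleftrightarrow>
    A \<in> \<Sigma> \<and> B \<in> \<Sigma> \<and> A \<noteq> B \<and> (\<exists>u\<in>A. \<exists>v\<in>B. {u, v} \<in> edges H \<and> \<omega> {u, v} = Directed u v)"
proof
  assume "(A, B) \<in> arcs (partition_graph H \<Sigma>) \<pi>"
  then obtain C D u v where e: "\<pi> {C, D} = Directed A B" "C \<in> \<Sigma>" "D \<in> \<Sigma>" "C \<noteq> D"
    "u \<in> C" "v \<in> D" "{u, v} \<in> edges H"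
    by (auto simp: arcs_def partition_graph_def)
  moreover have "{v, u} = {u, v}" by blast
  ultimately show "A \<in> \<Sigma> \<and> B \<in> \<Sigma> \<and> A \<noteq> B \<and> (\<exists>u\<in>A. \<exists>v\<in>B. {u, v} \<in> edges H \<and> \<omega> {u, v} = Directed u v)"
    using pao_witness_cross[OF w e(2-7)] by (elim disjE conjE) (metis oriented_edge.inject(2))+
next
  assume "A \<in> \<Sigma> \<and> B \<in> \<Sigma> \<and> A \<noteq> B \<and> (\<exists>u\<in>A. \<exists>v\<in>B. {u, v} \<in> edges H \<and> \<omega> {u, v} = Directed u v)"
  then obtain u v where e: "A \<in> \<Sigma>" "B \<in> \<Sigma>" "A \<noteq> B" "u \<in> A" "v \<in> B" "{u, v} \<in> edges H"
    and d: "\<omega> {u, v} = Directed u v" by blast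
  have "u \<noteq> v"
    using w e by (auto simp: pao_witness_def connected_partition_def partition_on_def disjoint_def)
  then have "\<pi> {A, B} = Directed A B" using pao_witness_cross[OF w e] d by auto
  moreover have "{A, B} \<in> edges (partition_graph H \<Sigma>)" using e by (auto simp: partition_graph_def)
  ultimately show "(A, B) \<in> arcs (partition_graph H \<Sigma>) \<pi>" by (auto simp: arcs_def)
qed

text \<open>An induction principle for blocks: a block is connected through undirected edges, so a
  property passed along such edges spreads from one vertex to all.\<close>

lemma pao_witness_block_closed:
  assumes w: "pao_witness H \<omega> \<Sigma> \<pi>" and A: "A \<in> \<Sigma>" "u \<in> A" "v \<in> A" and "P u"
    and step: "\<And>x y. x \<in> A \<Longrightarrow> y \<in> A \<Longrightarrow> {x, y} \<in> edges H \<Longrightarrow> \<omega> {x, y} = Undirected {x, y} \<Longrightarrow> P x \<Longrightarrow> P y"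
  shows "P v"
proof -
  have "(u, v) \<in> {(x, y). {x, y} \<in> edges H \<and> {x, y} \<subseteq> A}\<^sup>*"
    using w A by (auto simp: pao_witness_def connected_partition_def connected_graph_def induced_subgraph_def)
  then show ?thesis
  proof (induction rule: rtrancl_induct)
    case (step x y)
    then have "{x, y} \<in> edges H" "x \<in> A" "y \<in> A" by auto
    then show ?case using assms(6)[of x y] step.IH w A by (auto simp: pao_witness_def)
  qed fact
qed

text \<open>Describes ideals by vertices instead of blocks: closure along undirected edges makes
  \<open>U\<close> a union of blocks, and closure against arcs makes these blocks a
  down-set.\<close>

lemma pao_ideals_eq:
  assumes H: "simple_graph H" and "pao H \<omega>"
  shows "pao_ideals H \<omega> = {U. U \<subseteq> verts H \<and>
    (\<forall>u v. {u, v} \<in> edges H \<longrightarrow> v \<in> U \<longrightarrow> \<omega> {u, v} \<in> {Undirected {u, v}, Directed u v} \<longrightarrow> u \<in> U)}"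
    (is "_ = ?R")
proof -
  obtain \<Sigma> \<pi> where w: "pao_witness H \<omega> \<Sigma> \<pi>" using \<open>pao H \<omega>\<close> by (auto simp: pao_def)
  let ?a = "arcs (partition_graph H \<Sigma>) \<pi>"
  have part: "partition_on (verts H) \<Sigma>"
    using w by (auto simp: pao_witness_def connected_partition_def)
  have EV: "u \<in> verts H" "v \<in> verts H" if "{u, v} \<in> edges H" for u v
    using H that by (auto simp: simple_graph_def)
  have fwd: "\<Union>I \<in> ?R" if I: "order_ideal \<Sigma> (?a\<^sup>*) I" for I
  proof -
    have "u \<in> \<Union>I" if e: "{u, v} \<in> edges H" and "v \<in> \<Union>I"
      and d: "\<omega> {u, v} \<in> {Undirected {u, v}, Directed u v}" for u v
    proof -
      obtain B where B: "B \<in> I" "B \<in> \<Sigma>" "v \<in> B" 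
        using \<open>v \<in> \<Union>I\<close> I unfolding order_ideal_def by blast
      obtain A where A: "A \<in> \<Sigma>" "u \<in> A" using EV[OF e] part unfolding partition_on_def by blast
      show ?thesis
      proof (cases "A = B")
        case False
        then have "\<omega> {u, v} = Directed u v"
          using pao_witness_cross[OF w A(1) B(2) False A(2) B(3) e] d by auto
        then have "(A, B) \<in> ?a"
          using pao_witness_arcs_iff[OF w] A B False e by blast
        then have "A \<in> I" using I A B by (auto simp: order_ideal_def)
        then show ?thesis using A by blast
      qed (use A B in blast)
    qed
    moreover have "\<Union>I \<subseteq> verts H" using I part by (auto simp: order_ideal_def partition_on_def)
    ultimately show ?thesis by blast
  qed
  have bwd: "\<exists>I. U = \<Union>I \<and> order_ideal \<Sigma> (?a\<^sup>*) I" if U: "U \<in> ?R" for U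
  proof -
    have sub: "A \<subseteq> U" if "A \<in> \<Sigma>" "u \<in> A" "u \<in> U" for A u
    proof
      fix v assume "v \<in> A"
      show "v \<in> U"
      proof (rule pao_witness_block_closed[OF w \<open>A \<in> \<Sigma>\<close> \<open>u \<in> A\<close> \<open>v \<in> A\<close>, where P = "\<lambda>v. v \<in> U"])
        fix x y assume xy: "{x, y} \<in> edges H" "\<omega> {x, y} = Undirected {x, y}" "x \<in> U"
        then have "{y, x} \<in> edges H" "\<omega> {y, x} = Undirected {y, x}" by (simp_all add: insert_commute)
        then show "y \<in> U" using U xy by blast
      qed fact
    qed
    \<comment> \<open>By \<open>sub\<close>, a block meeting \<open>U\<close> is contained in
      \<open>U\<close>, so these blocks cover \<open>U\<close>.\<close>
    define I where "I = {A \<in> \<Sigma>. A \<subseteq> U}"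
    have "U = \<Union>I"
    proof
      show "U \<subseteq> \<Union>I"
      proof
        fix u assume u: "u \<in> U"
        then have "u \<in> \<Union>\<Sigma>" using U part by (auto simp: partition_on_def)
        then show "u \<in> \<Union>I" using sub u by (auto simp: I_def)
      qed
    qed (auto simp: I_def)
    \<comment> \<open>Membership travels backwards one arc at a time: an arc into a block of
      \<open>I\<close> puts its tail into \<open>U\<close>, and \<open>sub\<close> then puts the
      whole block of the tail there.\<close>
    moreover have "A \<in> I" if "(A, B) \<in> ?a\<^sup>*" "B \<in> I" for A B
      using that
    proof (induction rule: converse_rtrancl_induct)
      case (step A C)
      then obtain u v where "A \<in> \<Sigma>" "u \<in> A" "v \<in> C" "{u, v} \<in> edges H" "\<omega> {u, v} = Directed u v"
        using pao_witness_arcs_iff[OF w] by blast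
      moreover have "v \<in> U" using step \<open>v \<in> C\<close> by (auto simp: I_def)
      ultimately have "u \<in> U" using U by blast
      then show ?case using sub \<open>A \<in> \<Sigma>\<close> \<open>u \<in> A\<close> by (auto simp: I_def)
    qed
    then have "order_ideal \<Sigma> (?a\<^sup>*) I" by (auto simp: order_ideal_def I_def)
    ultimately show ?thesis by blast
  qed
  have "pao_ideals H \<omega> = {\<Union>I | I. order_ideal \<Sigma> (?a\<^sup>*) I}"
    unfolding pao_ideals_def pao_order_def pao_witness_eq[OF w] ..
  also have "\<dots> = ?R"
    by (intro subset_antisym subsetI) (use fwd in fast, use bwd in simp)
  finally show ?thesis .
qed

text \<open>Topological sorting: a block is weighted by the number of blocks strictly reachable from
  it.\<close>

lemma pao_imp_weight_orientation:
  assumes H: "simple_graph H" and pao: "pao H \<omega>"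
  obtains f :: "'a \<Rightarrow> nat" where "\<And>v. 0 < f v" "\<omega> = weight_orientation H f"
proof -
  obtain \<Sigma> \<pi> where w: "pao_witness H \<omega> \<Sigma> \<pi>" using pao by (auto simp: pao_def)
  let ?a = "arcs (partition_graph H \<Sigma>) \<pi>"
  have part: "partition_on (verts H) \<Sigma>" and acyc: "acyclic ?a"
    using w by (auto simp: pao_witness_def connected_partition_def acyclic_orientation_def)
  have "finite (verts H)" using H by (simp add: simple_graph_def)
  then have fin: "finite \<Sigma>" using part finite_elements by blast
  have a\<Sigma>: "?a \<subseteq> \<Sigma> \<times> \<Sigma>" using pao_witness_arcs_iff[OF w] by auto
  define h where "h A = card {C. (A, C) \<in> ?a\<^sup>+}" for A
  \<comment> \<open>\<open>Suc\<close> makes all weights positive, so that after normalisation no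
    vertex of the support gets coordinate 0.\<close>
  define f where "f u = Suc (h (THE A. A \<in> \<Sigma> \<and> u \<in> A))" for u
  have f_eq: "f u = Suc (h A)" if "A \<in> \<Sigma>" "u \<in> A" for A u
  proof -
    have "(THE A. A \<in> \<Sigma> \<and> u \<in> A) = A"
      using part that by (intro the_equality) (auto simp: partition_on_def disjoint_def)
    then show ?thesis by (simp add: f_def)
  qed
  have h_less: "h B < h A" if AB: "(A, B) \<in> ?a" for A B
    unfolding h_def
  proof (rule psubset_card_mono)
    have "{C. (A, C) \<in> ?a\<^sup>+} \<subseteq> \<Sigma>" using trancl_subset_Sigma[OF a\<Sigma>] by auto
    then show "finite {C. (A, C) \<in> ?a\<^sup>+}" using fin finite_subset by blast
    \<comment> \<open>The inclusion is proper: \<open>B\<close> is reachable from \<open>A\<close>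
      but, by acyclicity, not from itself.\<close>
    have "(B, B) \<notin> ?a\<^sup>+" using acyc by (auto simp: acyclic_def)
    then show "{C. (B, C) \<in> ?a\<^sup>+} \<subset> {C. (A, C) \<in> ?a\<^sup>+}"
      using AB by (auto intro: trancl_into_trancl2)
  qed
  have edge: "(f u = f v \<and> \<omega> {u, v} = Undirected {u, v}) \<or> (f v < f u \<and> \<omega> {u, v} = Directed u v) \<or>
    (f u < f v \<and> \<omega> {u, v} = Directed v u)" if e: "{u, v} \<in> edges H" for u v
  proof -
    have "u \<in> verts H" "v \<in> verts H" using H e by (auto simp: simple_graph_def)
    then obtain A B where AB: "A \<in> \<Sigma>" "B \<in> \<Sigma>" "u \<in> A" "v \<in> B"
      using part unfolding partition_on_def by blast
    show ?thesis
    proof (cases "A = B")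
      case True
      then show ?thesis using AB e w by (auto simp: pao_witness_def f_eq)
    next
      case False
      have e': "{A, B} \<in> edges (partition_graph H \<Sigma>)" using AB False e by (auto simp: partition_graph_def)
      then have "(A, B) \<in> ?a \<and> \<omega> {u, v} = Directed u v \<or> (B, A) \<in> ?a \<and> \<omega> {u, v} = Directed v u"
        using pao_witness_cross[OF w AB(1,2) False AB(3,4) e] unfolding arcs_def by blast
      then show ?thesis using h_less AB by (auto simp: f_eq)
    qed
  qed
  have "\<omega> = weight_orientation H f"
  proof (rule orientation_eq_weight_orientation[OF H])
    show "orientation H \<omega>" using pao by (simp add: pao_def)
  qed (use edge in fastforce)+
  moreover have "0 < f v" for v by (simp add: f_def)
  ultimately show ?thesis using that by blast
qed

text \<open>Only strict comparisons along edges enter the definition. The two weights may have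
  different types, which allows passing from natural to real weights.\<close>

lemma weight_orientation_cong:
  assumes "\<And>u v. {u, v} \<in> edges H \<Longrightarrow> f v < f u \<longleftrightarrow> g v < g u"
  shows "weight_orientation H f = weight_orientation H g"
  unfolding weight_orientation_def
proof (rule restrict_ext)
  fix e assume "e \<in> edges H"
  then have *: "e = {u, v} \<and> f v < f u \<longleftrightarrow> e = {u, v} \<and> g v < g u" for u v
    using assms by blast
  show "(if \<exists>u v. e = {u, v} \<and> f v < f u
      then SOME d. \<exists>u v. d = Directed u v \<and> e = {u, v} \<and> f v < f u else Undirected e) =
    (if \<exists>u v. e = {u, v} \<and> g v < g u
      then SOME d. \<exists>u v. d = Directed u v \<and> e = {u, v} \<and> g v < g u else Undirected e)"
    unfolding * ..
qed

lemma simple_graph_induced_subgraph: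
  "simple_graph G \<Longrightarrow> \<sigma> \<subseteq> verts G \<Longrightarrow> simple_graph (induced_subgraph G \<sigma>)"
  by (auto simp: simple_graph_def induced_subgraph_def intro: finite_subset)

section \<open>Labelling cells by partial acyclic orientations\<close>

definition cell_label :: "'n::finite ugraph \<Rightarrow> real ^ 'n \<Rightarrow> 'n set \<times> ('n set \<Rightarrow> 'n oriented_edge)" where
  "cell_label G w = ({i. w $ i \<noteq> 0}, weight_orientation (induced_subgraph G {i. w $ i \<noteq> 0}) (($) w))"

definition label_ideals :: "'a ugraph \<Rightarrow> 'a set \<times> ('a set \<Rightarrow> 'a oriented_edge) \<Rightarrow> 'a set set" where
  "label_ideals G = (\<lambda>(\<sigma>, \<omega>). pao_ideals (induced_subgraph G \<sigma>) \<omega>)"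

lemma abs_le_iff: "abs_le G x y \<longleftrightarrow> label_ideals G x \<subseteq> label_ideals G y"
  by (auto simp: abs_le_def label_ideals_def split: prod.splits)

context
  fixes G :: "'n::finite ugraph"
  assumes simple: "simple_graph G" and verts: "verts G = UNIV"
begin

lemma simple_graph_induced: "simple_graph (induced_subgraph G \<sigma>)"
  by (simp add: simple verts simple_graph_induced_subgraph)

text \<open>Predecessors are the heavier neighbours, so ideals are closed upwards in weight. The
  condition can be stated on edges of \<open>G\<close> instead of the induced subgraph.\<close>

lemma label_ideals_cell_label:
  assumes w: "w \<in> std_simplex"
  shows "label_ideals G (cell_label G w) = {U. (\<forall>i\<in>U. w $ i \<noteq> 0) \<and>
    (\<forall>i j. {i, j} \<in> edges G \<longrightarrow> i \<in> U \<longrightarrow> w $ i \<le> w $ j \<longrightarrow> j \<in> U)}"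
proof -
  let ?\<sigma> = "{i. w $ i \<noteq> 0}"
  let ?H = "induced_subgraph G ?\<sigma>"
  let ?o = "weight_orientation ?H (($) w)"
  have nonneg: "0 \<le> w $ i" for i using w by (simp add: mem_std_simplex_iff)
  have "label_ideals G (cell_label G w) = {U. U \<subseteq> ?\<sigma> \<and> (\<forall>j i. {j, i} \<in> edges ?H \<longrightarrow> i \<in> U \<longrightarrow>
      ?o {j, i} \<in> {Undirected {j, i}, Directed j i} \<longrightarrow> j \<in> U)}"
    unfolding label_ideals_def cell_label_def prod.case
    by (subst pao_ideals_eq[OF simple_graph_induced pao_weight_orientation[OF simple_graph_induced]])
       (simp add: induced_subgraph_def)
  also have "\<dots> = {U. U \<subseteq> ?\<sigma> \<and> (\<forall>i j. {i, j} \<in> edges G \<longrightarrow> i \<in> U \<longrightarrow> w $ i \<le> w $ j \<longrightarrow> j \<in> U)}"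
  proof (intro Collect_cong conj_cong refl)
    fix U assume U: "U \<subseteq> ?\<sigma>"
    have "({j, i} \<in> edges ?H \<longrightarrow> i \<in> U \<longrightarrow> ?o {j, i} \<in> {Undirected {j, i}, Directed j i} \<longrightarrow> j \<in> U) \<longleftrightarrow>
      ({i, j} \<in> edges G \<longrightarrow> i \<in> U \<longrightarrow> w $ i \<le> w $ j \<longrightarrow> j \<in> U)" for i j
    proof (cases "{j, i} \<in> edges ?H")
      case True
      then have e: "{i, j} \<in> edges G" "i \<noteq> j"
        using simple by (auto simp: induced_subgraph_def insert_commute simple_graph_def)
      from True have "?o {j, i} \<in> {Undirected {j, i}, Directed j i} \<longleftrightarrow> w $ i \<le> w $ j"
        by (cases rule: weight_orientation_cases[where f = "($) w"]) (use e in auto)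
      then show ?thesis using True e by blast
    next
      \<comment> \<open>An edge of \<open>G\<close> missing from \<open>?H\<close> but starting in
        \<open>U\<close> ends at weight 0, which is below the positive weight of \<open>i\<close>,
        so both conditions are vacuous.\<close>
      case False
      then have "w $ j = 0" if "{i, j} \<in> edges G" "i \<in> U"
        using U that by (auto simp: induced_subgraph_def insert_commute)
      moreover have "0 < w $ i" if "i \<in> U"
        using U that nonneg[of i] by (auto simp: less_le)
      ultimately show ?thesis using False by force
    qed
    then show "(\<forall>j i. {j, i} \<in> edges ?H \<longrightarrow> i \<in> U \<longrightarrow> ?o {j, i} \<in> {Undirected {j, i}, Directed j i} \<longrightarrow> j \<in> U) \<longleftrightarrow>
      (\<forall>i j. {i, j} \<in> edges G \<longrightarrow> i \<in> U \<longrightarrow> w $ i \<le> w $ j \<longrightarrow> j \<in> U)"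
      by blast
  qed
  finally show ?thesis by blast
qed

lemma closed_cell_subset_iff_label_ideals:
  assumes w: "w \<in> std_simplex" and z: "z \<in> std_simplex"
  shows "closed_cell G z \<subseteq> closed_cell G w \<longleftrightarrow> label_ideals G (cell_label G z) \<subseteq> label_ideals G (cell_label G w)"
proof
  assume sub: "closed_cell G z \<subseteq> closed_cell G w"
  show "label_ideals G (cell_label G z) \<subseteq> label_ideals G (cell_label G w)"
  proof
    fix U assume "U \<in> label_ideals G (cell_label G z)"
    then have U: "\<And>i. i \<in> U \<Longrightarrow> z $ i \<noteq> 0"
      "\<And>i j. {i, j} \<in> edges G \<Longrightarrow> i \<in> U \<Longrightarrow> z $ i \<le> z $ j \<Longrightarrow> j \<in> U"
      by (auto simp: label_ideals_cell_label[OF z])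
    show "U \<in> label_ideals G (cell_label G w)"
    proof (cases "U = {}")
      case False
      \<comment> \<open>The barycentre of the face spanned by \<open>U\<close>. It lies in the cell
        of \<open>z\<close> because \<open>U\<close> is an ideal of \<open>z\<close>, and its two
        coordinate values allow \<open>U\<close> to be read off again from the constraints of
        \<open>w\<close>.\<close>
      define y :: "real ^ 'n" where "y = (\<chi> i. if i \<in> U then 1 / card U else 0)"
      have "card U > 0" using False by (simp add: card_gt_0_iff)
      then have "y \<in> closed_cell G z"
        using U by (auto simp: closed_cell_def mem_std_simplex_iff y_def sum.If_cases)
      then have y: "y \<in> closed_cell G w" using sub by blast
      have mem: "i \<in> U \<longleftrightarrow> y $ i = 1 / card U" "i \<notin> U \<longleftrightarrow> y $ i = 0" for i
        using \<open>card U > 0\<close> by (auto simp: y_def)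
      show ?thesis
        unfolding label_ideals_cell_label[OF w]
      proof (intro CollectI conjI ballI allI impI)
        fix i assume "i \<in> U"
        then show "w $ i \<noteq> 0" using y mem(2)[of i] by (auto simp: closed_cell_def)
      next
        fix i j assume "{i, j} \<in> edges G" "i \<in> U" "w $ i \<le> w $ j"
        then have "y $ i \<le> y $ j" using y by (auto simp: closed_cell_def)
        then show "j \<in> U" using \<open>i \<in> U\<close> mem(1)[of i] mem(2)[of j] \<open>card U > 0\<close> by auto
      qed
    qed (auto simp: label_ideals_cell_label[OF w])
  qed
next
  assume sub: "label_ideals G (cell_label G z) \<subseteq> label_ideals G (cell_label G w)"
  have nonneg: "0 \<le> z $ i" for i using z by (simp add: mem_std_simplex_iff)
  \<comment> \<open>The superlevel sets of \<open>z\<close> are ideals of \<open>z\<close>, hence ideals of \<open>w\<close>.\<close>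
  have level: "{k. t \<le> z $ k} \<in> label_ideals G (cell_label G w)" if "0 < t" for t
  proof -
    have "{k. t \<le> z $ k} \<in> label_ideals G (cell_label G z)"
      using that by (auto simp: label_ideals_cell_label[OF z] intro: order_trans)
    then show ?thesis using sub by blast
  qed
  \<comment> \<open>The superlevel set at height \<open>z $ i\<close> contains \<open>i\<close>, and
    ideals of \<open>w\<close> stay inside the support of \<open>w\<close>.\<close>
  have "z $ i = 0" if "w $ i = 0" for i
  proof (rule ccontr)
    assume "z $ i \<noteq> 0"
    then have "{k. z $ i \<le> z $ k} \<in> label_ideals G (cell_label G w)"
      using level[of "z $ i"] nonneg[of i] by (simp add: less_le)
    then show False using that by (auto simp: label_ideals_cell_label[OF w])
  qed
  \<comment> \<open>The superlevel set at height \<open>z $ i\<close> contains \<open>i\<close>,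
    hence, as an ideal of \<open>w\<close>, also \<open>j\<close>. Height 0 is treated apart because
    \<open>level\<close> needs a positive threshold.\<close>
  moreover have "z $ i \<le> z $ j" if "{i, j} \<in> edges G" "w $ i \<le> w $ j" for i j
  proof (cases "z $ i = 0")
    case False
    then have "{k. z $ i \<le> z $ k} \<in> label_ideals G (cell_label G w)"
      using level[of "z $ i"] nonneg[of i] by (auto simp: less_le)
    then show ?thesis using that by (auto simp: label_ideals_cell_label[OF w])
  qed (simp add: nonneg)
  ultimately have "z \<in> closed_cell G w" using z by (auto simp: closed_cell_def)
  then show "closed_cell G z \<subseteq> closed_cell G w" by (rule closed_cell_mono)
qed

text \<open>Makes the label map well defined and injective on cells. Equal labels have equal ideals;
  for equal cells, \<open>w\<close> and \<open>z\<close> lie in each other's cell and so share zeros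
  and comparisons along edges.\<close>

lemma cell_label_eq_iff:
  assumes w: "w \<in> std_simplex" and z: "z \<in> std_simplex"
  shows "cell_label G w = cell_label G z \<longleftrightarrow> closed_cell G w = closed_cell G z"
proof
  assume "cell_label G w = cell_label G z"
  then show "closed_cell G w = closed_cell G z"
    using closed_cell_subset_iff_label_ideals w z by (metis subset_antisym order_refl)
next
  assume "closed_cell G w = closed_cell G z"
  then have zw: "z \<in> closed_cell G w" "w \<in> closed_cell G z"
    using w z closed_cell_self by blast+
  have supp: "{i. w $ i \<noteq> 0} = {i. z $ i \<noteq> 0}"
    using zw by (auto simp: closed_cell_def)
  have "w $ j < w $ i \<longleftrightarrow> z $ j < z $ i" if "{i, j} \<in> edges G" for i j
  proof -
    have "w $ i \<le> w $ j \<longleftrightarrow> z $ i \<le> z $ j"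
      using zw that unfolding closed_cell_def by blast
    then show ?thesis by linarith
  qed
  then show "cell_label G w = cell_label G z"
    unfolding cell_label_def supp
    by (intro arg_cong2[where f = Pair] refl weight_orientation_cong) (auto simp: induced_subgraph_def)
qed

lemma cell_label_image: "cell_label G ` std_simplex = abs_cells G"
proof
  have "cell_label G w \<in> abs_cells G" if w: "w \<in> std_simplex" for w
  proof -
    have "{i. w $ i \<noteq> 0} \<noteq> {}"
    proof
      assume "{i. w $ i \<noteq> 0} = {}"
      then have "(\<Sum>i\<in>UNIV. w $ i) = 0" by (intro sum.neutral) auto
      then show False using w by (simp add: mem_std_simplex_iff)
    qed
    then show ?thesis
      using pao_weight_orientation[OF simple_graph_induced] by (auto simp: abs_cells_def cell_label_def verts)
  qed
  then show "cell_label G ` std_simplex \<subseteq> abs_cells G" by blast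
  show "abs_cells G \<subseteq> cell_label G ` std_simplex"
  proof
    fix x assume "x \<in> abs_cells G"
    then obtain \<sigma> \<omega> where x: "x = (\<sigma>, \<omega>)" "\<sigma> \<noteq> {}" "pao (induced_subgraph G \<sigma>) \<omega>"
      by (auto simp: abs_cells_def)
    obtain f :: "'n \<Rightarrow> nat" where f: "\<And>v. 0 < f v" "\<omega> = weight_orientation (induced_subgraph G \<sigma>) f"
      using pao_imp_weight_orientation[OF simple_graph_induced x(3)] by blast
    \<comment> \<open>Normalising the weights over \<sigma> preserves their comparisons, and their
      positivity makes the support exactly \<sigma>.\<close>
    define s where "s = (\<Sum>i\<in>\<sigma>. real (f i))"
    define w :: "real ^ 'n" where "w = (\<chi> i. if i \<in> \<sigma> then f i / s else 0)"
    have s: "0 < s" unfolding s_def using x f by (intro sum_pos) auto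
    have "(\<Sum>i\<in>UNIV. w $ i) = 1"
      using s by (simp add: w_def sum.If_cases s_def flip: sum_divide_distrib)
    then have "w \<in> std_simplex" using s by (auto simp: mem_std_simplex_iff w_def)
    moreover have supp: "{i. w $ i \<noteq> 0} = \<sigma>"
      using s f(1) by (auto simp: w_def)
    have "weight_orientation (induced_subgraph G \<sigma>) (($) w) = \<omega>"
      unfolding f(2) using s
      by (intro weight_orientation_cong) (auto simp: induced_subgraph_def w_def divide_less_cancel)
    then have "cell_label G w = x" by (simp add: cell_label_def supp x)
    ultimately show "x \<in> cell_label G ` std_simplex" by blast
  qed
qed

text \<open>The cell and the block barycentres \<open>b A\<close> have the same affine hull, and the
  barycentres are orthogonal because blocks are disjoint. The resulting
  \<open>card \<Sigma> - 1\<close> is \<open>abs_dim\<close>, since \<open>card \<sigma>\<close>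
  cancels there.\<close>

lemma aff_dim_closed_cell:
  assumes w: "w \<in> std_simplex"
  shows "aff_dim (closed_cell G w) = abs_dim G (cell_label G w)"
proof -
  define \<sigma> where "\<sigma> = {i. w $ i \<noteq> 0}"
  define H where "H = induced_subgraph G \<sigma>"
  define \<omega> where "\<omega> = weight_orientation H (($) w)"
  have label: "cell_label G w = (\<sigma>, \<omega>)" and H_verts: "verts H = \<sigma>"
    by (simp_all add: cell_label_def \<sigma>_def H_def \<omega>_def induced_subgraph_def)
  obtain \<Sigma> \<pi> where wit: "pao_witness H \<omega> \<Sigma> \<pi>"
    using pao_weight_orientation[OF simple_graph_induced] unfolding pao_def H_def \<omega>_def by blast
  then have part: "partition_on \<sigma> \<Sigma>"
    by (auto simp: pao_witness_def connected_partition_def H_verts)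
  have dis: "\<And>A C. A \<in> \<Sigma> \<Longrightarrow> C \<in> \<Sigma> \<Longrightarrow> A \<noteq> C \<Longrightarrow> A \<inter> C = {}" and un: "\<Union>\<Sigma> = \<sigma>"
    and ne: "\<And>A. A \<in> \<Sigma> \<Longrightarrow> A \<noteq> {}"
    using part by (auto simp: partition_on_def disjoint_def)
  have card: "0 < card A" if "A \<in> \<Sigma>" for A using ne[OF that] by (simp add: card_gt_0_iff)
  \<comment> \<open>This is the tie condition for the perturbation of \<open>w\<close> towards a
    block barycentre.\<close>
  have same_block: "i \<in> A \<longleftrightarrow> j \<in> A"
    if e: "{i, j} \<in> edges G" "w $ i = w $ j" "w $ i \<noteq> 0" and A: "A \<in> \<Sigma>" for i j A
  proof -
    have ij: "i \<in> \<sigma>" "j \<in> \<sigma>" using e by (auto simp: \<sigma>_def)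
    then obtain C D where CD: "C \<in> \<Sigma>" "D \<in> \<Sigma>" "i \<in> C" "j \<in> D" using un by blast
    have eH: "{i, j} \<in> edges H" using e ij by (simp add: H_def induced_subgraph_def)
    then have "\<omega> {i, j} = Undirected {i, j}" unfolding \<omega>_def using e(2) by (rule weight_orientation_tie)
    then have "C = D" using pao_witness_cross[OF wit CD(1,2) _ CD(3,4) eH] by fastforce
    then show ?thesis using CD A dis by blast
  qed
  define b :: "'n set \<Rightarrow> real ^ 'n" where "b A = (\<chi> i. if i \<in> A then 1 / card A else 0)" for A
  have b_sum: "(\<Sum>i\<in>UNIV. b A $ i) = 1" if "A \<in> \<Sigma>" for A
    using ne[OF that] by (simp add: b_def sum.If_cases)
  have supp_b: "{i. b A $ i \<noteq> 0} = A" if "A \<in> \<Sigma>" for A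
    using card[OF that] by (auto simp: b_def)
  then have inj: "inj_on b \<Sigma>" by (metis inj_onI)
  have "independent (b ` \<Sigma>)"
  proof (rule pairwise_orthogonal_independent)
    show "0 \<notin> b ` \<Sigma>"
    proof
      assume "0 \<in> b ` \<Sigma>"
      then obtain A where "A \<in> \<Sigma>" "b A = 0" by auto
      then show False using supp_b ne by fastforce
    qed
    show "pairwise orthogonal (b ` \<Sigma>)"
    proof (clarsimp simp: pairwise_def orthogonal_def)
      fix A C assume "A \<in> \<Sigma>" "C \<in> \<Sigma>" "b A \<noteq> b C"
      then have "A \<inter> C = {}" using dis by metis
      then show "b A \<bullet> b C = 0" by (auto simp: inner_vec_def b_def intro!: sum.neutral)
    qed
  qed
  then have "\<not> affine_dependent (b ` \<Sigma>)" using affine_dependent_imp_dependent by blast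
  then have dim_b: "aff_dim (b ` \<Sigma>) = int (card \<Sigma>) - 1"
    using aff_dim_affine_independent card_image[OF inj] by fastforce
  have "y \<in> affine hull (b ` \<Sigma>)" if y: "y \<in> closed_cell G w" for y
  proof -
    \<comment> \<open>Edges inside a block are ties of \<open>w\<close>, hence equations on its
      cell.\<close>
    have const: "y $ i = y $ k" if "A \<in> \<Sigma>" "i \<in> A" "k \<in> A" for A i k
    proof (rule pao_witness_block_closed[OF wit that, where P = "\<lambda>k. y $ i = y $ k"])
      fix x z assume xz: "{x, z} \<in> edges H" "\<omega> {x, z} = Undirected {x, z}" "y $ i = y $ x"
      have "w $ x = w $ z"
        using xz(1) by (cases rule: weight_orientation_cases[where f = "($) w"]) (use xz in \<open>auto simp: \<omega>_def\<close>)
      moreover have "{x, z} \<in> edges G" "{z, x} \<in> edges G"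
        using xz(1) by (auto simp: H_def induced_subgraph_def insert_commute)
      ultimately have "y $ x = y $ z" using y by (intro antisym) (auto simp: closed_cell_def)
      then show "y $ i = y $ z" using xz by simp
    qed simp
    have nonneg: "0 \<le> y $ i" for i using y by (simp add: closed_cell_def mem_std_simplex_iff)
    have zero: "y $ i = 0" if "i \<notin> \<sigma>" for i using y that by (auto simp: closed_cell_def \<sigma>_def)
    have "(\<Sum>A\<in>\<Sigma>. \<Sum>i\<in>A. y $ i) = (\<Sum>i\<in>\<Union>\<Sigma>. y $ i)"
      using sum.Union_disjoint[of \<Sigma> "($) y"] dis by simp
    also have "\<dots> = (\<Sum>i\<in>UNIV. y $ i)"
      by (rule sum.mono_neutral_left) (auto simp: un zero)
    also have "\<dots> = 1" using y by (simp add: closed_cell_def mem_std_simplex_iff)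
    \<comment> \<open>The coefficient of \<open>b A\<close> is the mass of \<open>y\<close> on
      \<open>A\<close>; these masses are nonnegative and sum to 1.\<close>
    finally have "(\<Sum>A\<in>\<Sigma>. (\<Sum>i\<in>A. y $ i) *\<^sub>R b A) \<in> convex hull (b ` \<Sigma>)"
      by (intro convex_sum convex_convex_hull) (auto intro: hull_inc sum_nonneg nonneg)
    also have "(\<Sum>A\<in>\<Sigma>. (\<Sum>i\<in>A. y $ i) *\<^sub>R b A) = y"
    proof (rule vec_eq_iff[THEN iffD2], rule allI)
      fix i
      show "(\<Sum>A\<in>\<Sigma>. (\<Sum>i\<in>A. y $ i) *\<^sub>R b A) $ i = y $ i"
      proof (cases "i \<in> \<sigma>")
        case True
        then obtain C where C: "C \<in> \<Sigma>" "i \<in> C" using un by blast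
        have "(\<Sum>A\<in>\<Sigma>. (\<Sum>i\<in>A. y $ i) *\<^sub>R b A) $ i = (\<Sum>A\<in>{C}. (\<Sum>i\<in>A. y $ i) * b A $ i)"
          unfolding sum_component vector_scaleR_component real_scaleR_def
          by (rule sum.mono_neutral_right) (use C dis in \<open>auto simp: b_def\<close>)
        moreover have "(\<Sum>k\<in>C. y $ k) = (\<Sum>k\<in>C. y $ i)"
          by (rule sum.cong[OF refl]) (rule const[OF C(1) _ C(2)])
        ultimately show ?thesis using C(2) ne[OF C(1)] by (simp add: b_def)
      next
        case False
        then have "b A $ i = 0" if "A \<in> \<Sigma>" for A using that un by (auto simp: b_def)
        then show ?thesis using zero[OF False] by simp
      qed
    qed
    finally show ?thesis using convex_hull_subset_affine_hull by blast
  qed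
  then have "aff_dim (closed_cell G w) \<le> aff_dim (affine hull (b ` \<Sigma>))"
    by (intro aff_dim_subset) blast
  \<comment> \<open>The barycentre may lie outside the cell, but a point slightly moved from
    \<open>w\<close> towards it lies inside, and the line through \<open>w\<close> and that point
    contains \<open>b A\<close>.\<close>
  moreover have "b A \<in> affine hull (closed_cell G w)" if A: "A \<in> \<Sigma>" for A
  proof -
    have A\<sigma>: "A \<subseteq> \<sigma>" using un A by blast
    obtain e where e: "0 < e" "w + e *\<^sub>R (b A - w) \<in> closed_cell G w"
    proof (rule closed_cell_perturb[OF w, of "b A - w" G])
      show "(\<Sum>i\<in>UNIV. (b A - w) $ i) = 0"
        using b_sum[OF A] w by (simp add: sum_subtractf mem_std_simplex_iff)
      show "(b A - w) $ i = 0" if "w $ i = 0" for i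
        using that A\<sigma> by (auto simp: b_def \<sigma>_def)
      show "(b A - w) $ i = (b A - w) $ j" if "{i, j} \<in> edges G" "w $ i = w $ j" "w $ i \<noteq> 0" for i j
        using same_block[OF that A] that by (simp add: b_def)
    qed
    have "(1 - 1 / e) *\<^sub>R w + (1 / e) *\<^sub>R (w + e *\<^sub>R (b A - w)) \<in> affine hull (closed_cell G w)"
      using e closed_cell_self[OF w] by (intro mem_affine[OF affine_affine_hull] hull_inc) auto
    also have "(1 - 1 / e) *\<^sub>R w + (1 / e) *\<^sub>R (w + e *\<^sub>R (b A - w)) = b A"
      using e(1) by (simp add: algebra_simps)
    finally show ?thesis .
  qed
  then have "aff_dim (b ` \<Sigma>) \<le> aff_dim (affine hull (closed_cell G w))"
    by (intro aff_dim_subset) blast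
  ultimately have "aff_dim (closed_cell G w) = int (card \<Sigma>) - 1"
    using dim_b by simp
  then show ?thesis
    unfolding label abs_dim_def prod.case pao_dim_def H_def[symmetric] pao_witness_eq(1)[OF wit]
    by (simp add: H_verts)
qed

end

section \<open>From labels of points to the bijection on open cells\<close>

theorem theorem2p27:
  fixes G :: "'n::finite ugraph"
  assumes "simple_graph G" and "verts G = UNIV" and "connected_graph G"
  shows "polytopal_complex (graphical_complex G) \<and>
    (\<exists>\<phi>. bij_betw \<phi> (open_cells (graphical_complex G)) (abs_cells G) \<and>
      (\<forall>c\<in>open_cells (graphical_complex G). \<forall>d\<in>open_cells (graphical_complex G).
         closure c \<subseteq> closure d \<longleftrightarrow> abs_le G (\<phi> c) (\<phi> d)) \<and>
      (\<forall>c\<in>open_cells (graphical_complex G). aff_dim c = abs_dim G (\<phi> c)))"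
proof -
  note G = assms(1,2)
  \<comment> \<open>The closure recovers the closed cell, and by \<open>cell_label_eq_iff\<close>
    the label does not depend on which defining point \<open>w\<close> is chosen.\<close>
  define \<phi> where "\<phi> c = cell_label G (SOME w. w \<in> std_simplex \<and> closure c = closed_cell G w)" for c
  have \<phi>: "\<phi> (rel_interior (closed_cell G w)) = cell_label G w" if w: "w \<in> std_simplex" for w
  proof -
    let ?P = "\<lambda>z. z \<in> std_simplex \<and> closure (rel_interior (closed_cell G w)) = closed_cell G z"
    have "?P (SOME z. ?P z)"
      by (rule someI[of ?P w]) (simp add: w closure_rel_interior_closed_cell)
    then show ?thesis
      unfolding \<phi>_def using cell_label_eq_iff[OF G _ w] by (simp add: closure_rel_interior_closed_cell)
  qed
  note cells = open_cells_graphical_complex[OF assms(1)]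
  have "bij_betw \<phi> (open_cells (graphical_complex G)) (abs_cells G)"
    unfolding bij_betw_def
  proof
    show "inj_on \<phi> (open_cells (graphical_complex G))"
      unfolding cells by (rule inj_onI) (auto simp: \<phi> cell_label_eq_iff[OF G])
    show "\<phi> ` open_cells (graphical_complex G) = abs_cells G"
      unfolding cells image_image cell_label_image[OF G, symmetric] by (intro image_cong) (auto simp: \<phi>)
  qed
  moreover have "closure c \<subseteq> closure d \<longleftrightarrow> abs_le G (\<phi> c) (\<phi> d)"
    if "c \<in> open_cells (graphical_complex G)" "d \<in> open_cells (graphical_complex G)" for c d
  proof -
    obtain w z where "w \<in> std_simplex" "c = rel_interior (closed_cell G w)"
      "z \<in> std_simplex" "d = rel_interior (closed_cell G z)"
      using \<open>c \<in> _\<close> \<open>d \<in> _\<close> unfolding cells by blast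
    then show ?thesis
      by (simp add: \<phi> abs_le_iff closure_rel_interior_closed_cell
          closed_cell_subset_iff_label_ideals[OF G])
  qed
  moreover have "aff_dim c = abs_dim G (\<phi> c)" if "c \<in> open_cells (graphical_complex G)" for c
    using that by (auto simp: cells \<phi> aff_dim_closed_cell[OF G] rel_interior_aff_dim convex_closed_cell)
  ultimately show ?thesis
    using polytopal_complex_graphical_complex[OF assms(1)] by blast
qed

end
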